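(* Consider the cutting-plane algorithm which, in every round $t$, queries the point $p_t=\mathsf{cg}\big(K_t+\tfrac1T\mathsf{B}\big)$, where $K_t$ is the current knowledge set. For every horizon $T\ge 1$, every hidden point $w^*\in\mathsf{B}$ and every (strong) separation oracle, this algorithm incurs regret $O(d\log T)$.
   Context: $\mathsf{B}=\{w\in\mathbb{R}^d:\|w\|_2\le 1\}$, $+$ denotes Minkowski sum, and $\mathsf{cg}(L)=\big(\int_L x\,dx\big)/\big(\int_L 1\,dx\big)$ is the center of gravity. Cutting-plane problem: there is a hidden $w^*\in\mathsf{B}$. In each round $t=1,\dots,T$ the learner queries a point $p_t$, and a (strong) separation oracle returns a unit vector $v_t$, chosen adversarially and possibly depending on $p_t$ and on the history, such that $\langle w^*,v_t\rangle\ge\langle p_t,v_t\rangle$. The regret is $\sum_{t=1}^T\langle w^*-p_t,v_t\rangle$. The knowledge set is $K_1=\mathsf{B}$ and $K_{t+1}=K_t\cap\{w:\langle w-p_t,v_t\rangle\ge0\}$. *)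

theory Defs
  imports "HOL-Analysis.Analysis"
begin

(* R^d is modelled as extensional functions {..<d} -> real, so that the
   dimension d can be quantified inside the statement (the O-constant must be
   uniform in d). Lebesgue measure on R^d is the product measure. *)

definition Rd :: "nat \<Rightarrow> (nat \<Rightarrow> real) set" where
  "Rd d = PiE {..<d} (\<lambda>_. UNIV)"

definition lebd :: "nat \<Rightarrow> (nat \<Rightarrow> real) measure" where
  "lebd d = PiM {..<d} (\<lambda>_. lborel)"

definition ip :: "nat \<Rightarrow> (nat \<Rightarrow> real) \<Rightarrow> (nat \<Rightarrow> real) \<Rightarrow> real" where
  "ip d x y = (\<Sum>i<d. x i * y i)"

definition nrm :: "nat \<Rightarrow> (nat \<Rightarrow> real) \<Rightarrow> real" where
  "nrm d x = sqrt (ip d x x)"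

definition vadd :: "nat \<Rightarrow> (nat \<Rightarrow> real) \<Rightarrow> (nat \<Rightarrow> real) \<Rightarrow> (nat \<Rightarrow> real)" where
  "vadd d x y = (\<lambda>i\<in>{..<d}. x i + y i)"

definition vscale :: "nat \<Rightarrow> real \<Rightarrow> (nat \<Rightarrow> real) \<Rightarrow> (nat \<Rightarrow> real)" where
  "vscale d c x = (\<lambda>i\<in>{..<d}. c * x i)"

definition unitball :: "nat \<Rightarrow> (nat \<Rightarrow> real) set" where
  "unitball d = {x \<in> Rd d. nrm d x \<le> 1}"

definition msum :: "nat \<Rightarrow> (nat \<Rightarrow> real) set \<Rightarrow> (nat \<Rightarrow> real) set \<Rightarrow> (nat \<Rightarrow> real) set" where
  "msum d A B = {vadd d a b | a b. a \<in> A \<and> b \<in> B}"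

definition cg :: "nat \<Rightarrow> (nat \<Rightarrow> real) set \<Rightarrow> (nat \<Rightarrow> real)" where
  "cg d L = (\<lambda>i\<in>{..<d}. (LINT x:L|lebd d. x i) / measure (lebd d) L)"

(* Knowledge sets of the algorithm with horizon T against oracle answers v.
   Rounds are indexed 0..T-1 (round t here = round t+1 of the paper):
   ks 0 = B, ks (t+1) = ks t \<inter> {w. <w - p_t, v_t> \<ge> 0},
   where p_t = cg(ks t + (1/T) B). *)
fun ks :: "nat \<Rightarrow> nat \<Rightarrow> (nat \<Rightarrow> nat \<Rightarrow> real) \<Rightarrow> nat \<Rightarrow> (nat \<Rightarrow> real) set" where
  "ks d T v 0 = unitball d"
| "ks d T v (Suc t) = ks d T v t \<inter>
     {w \<in> Rd d. ip d w (v t) \<ge> ip d (cg d (msum d (ks d T v t) (vscale d (1 / real T) ` unitball d))) (v t)}"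

definition query :: "nat \<Rightarrow> nat \<Rightarrow> (nat \<Rightarrow> nat \<Rightarrow> real) \<Rightarrow> nat \<Rightarrow> (nat \<Rightarrow> real)" where
  "query d T v t = cg d (msum d (ks d T v t) (vscale d (1 / real T) ` unitball d))"

definition regret :: "nat \<Rightarrow> nat \<Rightarrow> (nat \<Rightarrow> real) \<Rightarrow> (nat \<Rightarrow> nat \<Rightarrow> real) \<Rightarrow> real" where
  "regret d T w v = (\<Sum>t<T. ip d w (v t) - ip d (query d T v t) (v t))"

end

theory Submission
  imports Defs "HOL-Probability.Probability"
begin

text \<open>
  Let \<open>L\<^sub>t = K\<^sub>t + (1/T)B\<close>; its volume is the potential, which over the whole run drops by a factor of at
  most \<open>(T + 1)\<^sup>d\<close>, because every \<open>L\<^sub>t\<close> contains \<open>w + (1/T)B\<close>. A round with loss at most \<open>6d/T\<close> is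
  cheap. In any other round the volume drops by a constant factor: \<open>L\<^sub>t\<^sub>+\<^sub>1\<close> lies in the half-space cut off
  at distance \<open>1/T\<close> behind the centroid of \<open>L\<^sub>t\<close>, so a robust form of Gruenbaum's inequality is needed.
  For a uniform random point of \<open>L\<^sub>t\<close> let \<open>X\<close> be its signed distance from the hyperplane through the
  centroid and \<open>F\<close> the distribution function of \<open>X\<close>. By the Prekopa-Leindler inequality \<open>ln F\<close> is
  concave, and \<open>F(X)\<close> is essentially uniform; Jensen's inequality for \<open>ln F\<close>, applied first to \<open>X\<close> and then
  to \<open>min(X, 0)\<close>, gives \<open>F(0) \<ge> 1/4\<close> and \<open>F(- E X\<^sup>+) \<ge> 1/16\<close>. Finally \<open>E X\<^sup>+\<close> exceeds \<open>1/T\<close>,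
  as is seen by contracting \<open>L\<^sub>t\<close> towards the hidden point \<open>w\<close>.
\<close>

section \<open>The Prekopa-Leindler inequality\<close>

text \<open>A Borel set need not contain its supremum; an increasing sequence of elements that
  passes every point of the set replaces it. Without a maximum, above every element there is a
  rational that still lies below another element, so serving the countably many rationals suffices.
  Running maxima make the choice monotone.\<close>

lemma cofinal_sequence_real:
  fixes A :: "real set"
  assumes "A \<noteq> {}"
  obtains x :: "nat \<Rightarrow> real" where "incseq x" "range x \<subseteq> A" "A \<subseteq> (\<Union>n. {..x n})"
proof (cases "\<exists>m\<in>A. \<forall>a\<in>A. a \<le> m")
  case True
  then obtain m where "m \<in> A" "\<forall>a\<in>A. a \<le> m" by blast
  then show ?thesis by (intro that[of "\<lambda>_. m"]) (auto simp: incseq_def)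
next
  case False
  then have no_max: "\<exists>b\<in>A. a < b" if "a \<in> A" for a using that by (auto simp: not_le)
  obtain a0 where a0: "a0 \<in> A" using assms by blast
  obtain q :: "nat \<Rightarrow> rat" where q: "range q = UNIV"
    by (rule that[OF range_from_nat_into[OF UNIV_not_empty countableI_type]])
  have "\<exists>y. \<forall>n. y n \<in> A \<and> ((\<exists>a\<in>A. real_of_rat (q n) \<le> a) \<longrightarrow> real_of_rat (q n) \<le> y n)"
    using a0 by (intro choice) blast
  then obtain y where y: "y n \<in> A" "\<exists>a\<in>A. real_of_rat (q n) \<le> a \<Longrightarrow> real_of_rat (q n) \<le> y n" for n
    by blast
  define x where "x n = Max (y ` {..n})" for n
  show ?thesis
  proof (rule that[of x])
    show "incseq x" unfolding incseq_def x_def by (intro allI impI Max_mono) auto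
    have "x n \<in> y ` {..n}" for n unfolding x_def by (intro Max_in) auto
    then show "range x \<subseteq> A" using y(1) by (metis (no_types, lifting) imageE image_subsetI)
    show "A \<subseteq> (\<Union>n. {..x n})"
    proof
      fix a assume "a \<in> A"
      then obtain b where b: "b \<in> A" "a < b" using no_max by blast
      obtain r where r: "a < real_of_rat r" "real_of_rat r < b" using of_rat_dense b by blast
      obtain n where n: "q n = r" using q by (metis UNIV_I image_iff)
      have "real_of_rat r \<le> y n" using y(2)[of n] n b r by (metis less_imp_le)
      also have "y n \<le> x n" unfolding x_def by (intro Max_ge) auto
      finally show "a \<in> (\<Union>n. {..x n})" using r by (auto intro!: exI[of _ n])
    qed
  qed
qed

text \<open>Continuity from below along a cofinal sequence. The summand \<open>L\<close> allows two
  sets to be exhausted one after the other; the general \<open>M\<close> allows reuse for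
  probability distributions.\<close>

lemma emeasure_le_initial_segments:
  fixes M :: "real measure"
  assumes M: "sets M = sets borel" and A: "A \<in> sets borel" "A \<noteq> {}"
    and le: "\<And>a. a \<in> A \<Longrightarrow> L + emeasure M (A \<inter> {..a}) \<le> K"
  shows "L + emeasure M A \<le> K"
proof -
  obtain x where x: "incseq x" "range x \<subseteq> A" "A \<subseteq> (\<Union>n. {..x n})"
    using cofinal_sequence_real[OF A(2)] .
  have "(SUP n. emeasure M (A \<inter> {..x n})) = emeasure M (\<Union>n. A \<inter> {..x n})"
    using x(1) A M by (intro SUP_emeasure_incseq) (auto simp: incseq_def intro: order_trans)
  also have "(\<Union>n. A \<inter> {..x n}) = A" using x(3) by auto
  finally have "L + emeasure M A = (SUP n. L + emeasure M (A \<inter> {..x n}))"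
    by (simp add: ennreal_SUP_add_right[symmetric])
  then show ?thesis using le x(2) by (auto intro!: SUP_least)
qed

lemma emeasure_lborel_uminus:
  assumes "A \<in> sets borel"
  shows "emeasure lborel ((uminus :: real \<Rightarrow> real) -` A) = emeasure lborel A"
proof -
  have "emeasure lborel A = emeasure (distr lborel borel uminus) A"
    by (simp add: lborel_distr_uminus)
  also have "\<dots> = emeasure lborel (uminus -` A \<inter> space lborel)"
    using assms by (subst emeasure_distr) auto
  finally show ?thesis by simp
qed

text \<open>Reflection in the origin reduces this to initial segments.\<close>

lemma emeasure_lborel_le_final_segments:
  fixes A :: "real set"
  assumes A: "A \<in> sets borel" "A \<noteq> {}"
    and le: "\<And>a. a \<in> A \<Longrightarrow> L + emeasure lborel (A \<inter> {a..}) \<le> K"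
  shows "L + emeasure lborel A \<le> K"
proof -
  have "L + emeasure lborel (uminus -` A) \<le> K"
  proof (rule emeasure_le_initial_segments)
    show "uminus -` A \<in> sets borel" 
      using A(1) measurable_sets[of uminus borel borel A] by auto
    show "uminus -` A \<noteq> {}" using A(2) by (metis all_not_in_conv minus_minus vimage_eq)
    fix a assume a: "a \<in> uminus -` A"
    have "uminus -` A \<inter> {..a} = uminus -` (A \<inter> {-a..})" by auto
    then show "L + emeasure lborel (uminus -` A \<inter> {..a}) \<le> K"
      using le[of "-a"] a A(1) emeasure_lborel_uminus[of "A \<inter> {-a..}"] by simp
  qed simp
  then show ?thesis using A(1) by (simp add: emeasure_lborel_uminus)
qed

section \<open>The Brunn-Minkowski inequality on the real line\<close>

lemma emeasure_lborel_midpoint_vimage: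
  fixes b :: real
  assumes "A \<in> sets borel"
  shows "emeasure lborel ((\<lambda>z. 2 * z - b) -` A) = emeasure lborel A / 2"
proof -
  have m: "(\<lambda>z. 2 * z - b) -` A \<in> sets borel"
    using measurable_sets[of "\<lambda>z. 2 * z - b" borel borel A] assms by simp
  have "emeasure lborel A = (\<integral>\<^sup>+x. indicator A x \<partial>lborel)" using assms by simp
  also have "\<dots> = \<bar>2::real\<bar> * (\<integral>\<^sup>+x. indicator A (- b + 2 * x) \<partial>lborel)"
    using assms by (intro nn_integral_real_affine) auto
  also have "(\<integral>\<^sup>+x. indicator A (- b + 2 * x) \<partial>lborel) = (\<integral>\<^sup>+x. indicator ((\<lambda>z. 2 * z - b) -` A) x \<partial>lborel)"
    by (intro nn_integral_cong) (auto simp: indicator_def)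
  also have "\<dots> = emeasure lborel ((\<lambda>z. 2 * z - b) -` A)" using m by simp
  finally have "emeasure lborel A = emeasure lborel ((\<lambda>z. 2 * z - b) -` A) * 2"
    by (simp add: mult.commute)
  then show ?thesis by (simp add: ennreal_mult_divide_eq)
qed

lemma two_times_half_ennreal: "2 * (x / 2) = (x :: ennreal)"
proof -
  have "x * 2 / 2 = x" by (simp add: ennreal_mult_divide_eq)
  then show ?thesis by (metis ennreal_times_divide mult.commute)
qed

text \<open>The classical argument for compact sets places copies of \<open>A\<close> and
  \<open>B\<close> side by side, using \<open>max A\<close> and \<open>min B\<close>. Here arbitrary
  elements \<open>a\<close> and \<open>b\<close> take their place, and the pieces
  \<open>A \<inter> {..a}\<close> and \<open>B \<inter> {b..}\<close> are exhausted
  afterwards.\<close>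

lemma brunn_minkowski_real:
  fixes A B C :: "real set"
  assumes [measurable]: "A \<in> sets borel" "B \<in> sets borel" "C \<in> sets borel"
    and ne: "A \<noteq> {}" "B \<noteq> {}"
    and mid: "\<And>x y. x \<in> A \<Longrightarrow> y \<in> B \<Longrightarrow> (x + y) / 2 \<in> C"
  shows "emeasure lborel A + emeasure lborel B \<le> 2 * emeasure lborel C"
proof -
  have le: "emeasure lborel (A \<inter> {..a}) + emeasure lborel (B \<inter> {b..}) \<le> 2 * emeasure lborel C"
    if ab: "a \<in> A" "b \<in> B" for a b
  proof -
    \<comment> \<open>The midpoints of \<open>A \<inter> {..a}\<close> with \<open>b\<close> and of
      \<open>B \<inter> {b..}\<close> with \<open>a\<close>, written as preimages so that
      measurability is immediate. Both sets lie in \<open>C\<close>, on opposite sides of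
      \<open>(a + b) / 2\<close>, so their measures add.\<close>
    let ?A = "(\<lambda>z. 2 * z - b) -` (A \<inter> {..a})" and ?B = "(\<lambda>z. 2 * z - a) -` (B \<inter> {b..})"
    have meas: "?A \<in> sets lborel" "?B \<in> sets lborel"
      using measurable_sets[of "\<lambda>z. 2 * z - b" borel borel "A \<inter> {..a}"]
        measurable_sets[of "\<lambda>z. 2 * z - a" borel borel "B \<inter> {b..}"] by auto
    have sub: "?A \<inter> ?B \<subseteq> {(a + b) / 2}" by auto
    have null: "?A \<inter> ?B \<in> null_sets lborel"
      by (rule finite_imp_null_set_lborel[OF finite_subset[OF sub]]) (rule finite.insertI[OF finite.emptyI])
    have "emeasure lborel (A \<inter> {..a}) / 2 + emeasure lborel (B \<inter> {b..}) / 2 = emeasure lborel ?A + emeasure lborel ?B"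
      using emeasure_lborel_midpoint_vimage[of "A \<inter> {..a}" b] emeasure_lborel_midpoint_vimage[of "B \<inter> {b..}" a]
      by (simp only: assms(1,2) sets.Int atMost_borel atLeast_borel simp_thms)
    also have "\<dots> = emeasure lborel (?A \<union> ?B)"
      by (rule emeasure_Un'[symmetric, OF meas null])
    also have "\<dots> \<le> emeasure lborel C"
    proof (rule emeasure_mono)
      show "?A \<union> ?B \<subseteq> C"
      proof
        fix z assume "z \<in> ?A \<union> ?B"
        then have "2 * z - b \<in> A \<or> 2 * z - a \<in> B" by blast
        then show "z \<in> C"
        proof
          assume "2 * z - b \<in> A"
          from mid[OF this ab(2)] show ?thesis by simp
        next
          assume "2 * z - a \<in> B"
          from mid[OF ab(1) this] show ?thesis by simp
        qed
      qed
    qed simp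
    finally have "2 * (emeasure lborel (A \<inter> {..a}) / 2 + emeasure lborel (B \<inter> {b..}) / 2) \<le> 2 * emeasure lborel C"
      by (intro mult_left_mono) auto
    moreover have "2 * (x / 2) = x" for x :: ennreal
      by (rule two_times_half_ennreal)
    ultimately show ?thesis by (simp only: distrib_left)
  qed
  have "emeasure lborel B + emeasure lborel (A \<inter> {..a}) \<le> 2 * emeasure lborel C" if "a \<in> A" for a
    using emeasure_lborel_le_final_segments[OF assms(2) ne(2) le[OF that]] by (subst add.commute)
  then have "emeasure lborel B + emeasure lborel A \<le> 2 * emeasure lborel C"
    by (rule emeasure_le_initial_segments[OF sets_lborel assms(1) ne(1)])
  then show ?thesis by (subst add.commute)
qed

section \<open>The Prekopa-Leindler inequality on the real line\<close>

lemma ennreal_mult_le_square_mean: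
  fixes a b c :: ennreal
  assumes "a + b \<le> 2 * c"
  shows "a * b \<le> c ^ 2"
proof (cases "c = \<infinity>")
  case True
  then show ?thesis by (simp add: power2_eq_square)
next
  case False
  then obtain z where z: "z \<ge> 0" "c = ennreal z" by (cases c) auto
  have "2 * c < \<infinity>" using False by (simp add: ennreal_mult_less_top less_top)
  then have "a + b < \<infinity>" using assms by (rule le_less_trans[rotated])
  then obtain x y where xy: "x \<ge> 0" "a = ennreal x" "y \<ge> 0" "b = ennreal y"
    by (cases a; cases b) auto
  have "ennreal (x + y) \<le> ennreal (2 * z)"
    using assms z xy by (simp add: ennreal_mult'')
  then have "x + y \<le> 2 * z" using z by (simp add: ennreal_le_iff)
  then have "(x + y)\<^sup>2 \<le> (2 * z)\<^sup>2" using xy by (intro power_mono) auto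
  moreover have "4 * (x * y) \<le> (x + y)\<^sup>2" using zero_le_power2[of "x - y"] by (simp add: power2_eq_square algebra_simps)
  ultimately have "x * y \<le> z\<^sup>2" by (simp add: power2_eq_square)
  then show ?thesis using z xy by (simp add: ennreal_mult[symmetric] ennreal_power)
qed

text \<open>Layer-cake formula, by Fubini. The bound by \<open>1\<close> confines the levels to the
  unit interval.\<close>

lemma nn_integral_superlevel_sets:
  fixes f :: "real \<Rightarrow> ennreal"
  assumes [measurable]: "f \<in> borel_measurable borel" and le1: "\<And>x. f x \<le> 1"
  shows "(\<integral>\<^sup>+x. f x \<partial>lborel) = (\<integral>\<^sup>+t. indicator {0<..<1} t * emeasure lborel {x. ennreal t < f x} \<partial>lborel)"
proof -
  have "f x = (\<integral>\<^sup>+t. indicator {0<..<1} t * indicator {x. ennreal t < f x} x \<partial>lborel)" for x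
  proof -
    obtain r where r: "0 \<le> r" "r \<le> 1" "f x = ennreal r"
      using le1[of x] by (cases "f x") (auto simp: ennreal_le_1 top_unique)
    have "(\<integral>\<^sup>+t. indicator {0<..<1} t * indicator {x. ennreal t < f x} x \<partial>lborel) = (\<integral>\<^sup>+t. indicator {0<..<r} t \<partial>lborel)"
      using r by (intro nn_integral_cong) (auto simp: indicator_def ennreal_less_iff)
    then show ?thesis using r by simp
  qed
  then have "(\<integral>\<^sup>+x. f x \<partial>lborel) = (\<integral>\<^sup>+x. (\<integral>\<^sup>+t. indicator {0<..<1} t * indicator {x. ennreal t < f x} x \<partial>lborel) \<partial>lborel)"
    by (rule nn_integral_cong)
  also have "\<dots> = (\<integral>\<^sup>+t. (\<integral>\<^sup>+x. indicator {0<..<1} t * indicator {x. ennreal t < f x} x \<partial>lborel) \<partial>lborel)"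
  proof (rule lborel_pair.Fubini')
    have "(\<lambda>(t, x). indicator {0<..<1::real} t * indicator {p. ennreal (fst p) < f (snd p)} (t, x) :: ennreal)
      \<in> borel_measurable (lborel \<Otimes>\<^sub>M lborel)"
      by measurable
    then show "(\<lambda>(t, x). indicator {0<..<1::real} t * indicator {x. ennreal t < f x} x :: ennreal)
      \<in> borel_measurable (lborel \<Otimes>\<^sub>M lborel)"
      by (simp add: indicator_def)
  qed
  also have "\<dots> = (\<integral>\<^sup>+t. indicator {0<..<1} t * emeasure lborel {x. ennreal t < f x} \<partial>lborel)"
    by (intro nn_integral_cong) (simp add: nn_integral_cmult)
  finally show ?thesis .
qed

text \<open>With both suprema equal to \<open>1\<close>, all superlevel sets at levels below
  \<open>1\<close> are nonempty, so the Brunn-Minkowski inequality applies level by level and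
  integrates to an additive estimate.\<close>

lemma prekopa_leindler_real_normalized:
  fixes f g h :: "real \<Rightarrow> ennreal"
  assumes meas[measurable]: "f \<in> borel_measurable borel" "g \<in> borel_measurable borel" "h \<in> borel_measurable borel"
    and le1: "\<And>x. f x \<le> 1" "\<And>x. g x \<le> 1"
    and sup: "\<And>t. t < 1 \<Longrightarrow> \<exists>x. t < f x" "\<And>t. t < 1 \<Longrightarrow> \<exists>x. t < g x"
    and mid: "\<And>x y. f x * g y \<le> (h ((x + y) / 2))\<^sup>2"
  shows "(\<integral>\<^sup>+x. f x \<partial>lborel) + (\<integral>\<^sup>+x. g x \<partial>lborel) \<le> 2 * (\<integral>\<^sup>+x. h x \<partial>lborel)"
proof -
  \<comment> \<open>Truncation at \<open>1\<close> makes \<open>h\<close> fit the layer-cake formula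
    and leaves its superlevel sets at levels below \<open>1\<close> unchanged.\<close>
  let ?h = "\<lambda>x. min (h x) 1"
  let ?L = "\<lambda>f t. emeasure lborel {x. ennreal t < f x}"
  have level: "?L f t + ?L g t \<le> 2 * ?L ?h t" if t: "0 < t" "t < 1" for t :: real
  proof (rule brunn_minkowski_real)
    have t1: "ennreal t < 1" using t by (metis ennreal_1 ennreal_less_iff less_imp_le)
    show "{x. ennreal t < f x} \<noteq> {}" "{x. ennreal t < g x} \<noteq> {}" using sup[OF t1] by auto
    fix x y assume xy: "x \<in> {x. ennreal t < f x}" "y \<in> {x. ennreal t < g x}"
    show "(x + y) / 2 \<in> {x. ennreal t < ?h x}"
    proof (rule ccontr)
      assume "(x + y) / 2 \<notin> {x. ennreal t < ?h x}"
      then have "h ((x + y) / 2) \<le> ennreal t" using t1 by (auto simp: not_less min_def split: if_splits)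
      then have "(h ((x + y) / 2))\<^sup>2 \<le> (ennreal t)\<^sup>2" by (intro power_mono) auto
      then have le: "f x * g y \<le> ennreal t * ennreal t" using mid[of x y] by (simp add: power2_eq_square)
      obtain a b where ab: "a \<ge> 0" "f x = ennreal a" "b \<ge> 0" "g y = ennreal b"
        using le1(1)[of x] le1(2)[of y] by (cases "f x"; cases "g y") (auto simp: top_unique)
      have "t < a" "t < b" using xy ab t by (auto simp: ennreal_less_iff)
      moreover from this have "t * t < a * b" using t by (intro mult_strict_mono) auto
      ultimately show False using le ab t by (auto simp: ennreal_mult[symmetric] ennreal_le_iff)
    qed
  qed measurable
  have "(\<integral>\<^sup>+x. f x \<partial>lborel) + (\<integral>\<^sup>+x. g x \<partial>lborel)
    = (\<integral>\<^sup>+t. indicator {0<..<1} t * ?L f t + indicator {0<..<1} t * ?L g t \<partial>lborel)"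
    using le1 by (simp add: nn_integral_superlevel_sets nn_integral_add)
  also have "\<dots> \<le> (\<integral>\<^sup>+t. 2 * (indicator {0<..<1} t * ?L ?h t) \<partial>lborel)"
    using level by (intro nn_integral_mono) (auto simp: indicator_def)
  also have "\<dots> = 2 * (\<integral>\<^sup>+x. ?h x \<partial>lborel)"
    by (subst nn_integral_superlevel_sets[of ?h]) (auto intro!: nn_integral_cmult)
  also have "\<dots> \<le> 2 * (\<integral>\<^sup>+x. h x \<partial>lborel)"
    by (intro mult_left_mono nn_integral_mono) auto
  finally show ?thesis .
qed

text \<open>Dividing \<open>f\<close> and \<open>g\<close> by their suprema \<open>a\<close> and
  \<open>b\<close>, and \<open>h\<close> by \<open>sqrt (a * b)\<close>, preserves the midpoint
  hypothesis. The additive estimate then becomes multiplicative by the inequality between arithmetic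
  and geometric mean.\<close>

lemma prekopa_leindler_real_bounded:
  fixes f g h :: "real \<Rightarrow> ennreal"
  assumes meas[measurable]: "f \<in> borel_measurable borel" "g \<in> borel_measurable borel" "h \<in> borel_measurable borel"
    and le: "\<And>x. f x \<le> ennreal a'" "\<And>x. g x \<le> ennreal b'"
    and mid: "\<And>x y. f x * g y \<le> (h ((x + y) / 2))\<^sup>2"
  shows "(\<integral>\<^sup>+x. f x \<partial>lborel) * (\<integral>\<^sup>+x. g x \<partial>lborel) \<le> (\<integral>\<^sup>+x. h x \<partial>lborel)\<^sup>2"
proof (cases "(SUP x. f x) = 0 \<or> (SUP x. g x) = 0")
  case True
  then have "(\<forall>x. f x = 0) \<or> (\<forall>x. g x = 0)" by (metis SUP_upper UNIV_I le_zero_eq)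
  then show ?thesis by auto
next
  case False
  obtain a where a: "(SUP x. f x) = ennreal a" "a > 0"
  proof -
    have "(SUP x. f x) \<le> ennreal a'" using le by (intro SUP_least) auto
    then show thesis using that False by (cases "SUP x. f x") (auto simp: top_unique less_le)
  qed
  obtain b where b: "(SUP x. g x) = ennreal b" "b > 0"
  proof -
    have "(SUP x. g x) \<le> ennreal b'" using le by (intro SUP_least) auto
    then show thesis using that False by (cases "SUP x. g x") (auto simp: top_unique less_le)
  qed
  define c where "c = sqrt (a * b)"
  have c: "c > 0" "c * c = a * b" using a b by (auto simp: c_def)
  let ?I = "\<lambda>f. \<integral>\<^sup>+x. f x \<partial>lborel"
  have le1: "f x / ennreal s \<le> 1" if "(SUP x. f x) = ennreal s" "s > 0" for f :: "real \<Rightarrow> ennreal" and s x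
  proof -
    have "f x \<le> ennreal s" using that(1) by (metis SUP_upper UNIV_I)
    then have "f x / ennreal s \<le> ennreal s / ennreal s" by (rule divide_right_mono_ennreal)
    then show ?thesis using that(2) by simp
  qed
  have sup1: "\<exists>x. t < f x / ennreal s" if fs: "(SUP x. f x) = ennreal s" "s > 0" and t: "t < 1" for f :: "real \<Rightarrow> ennreal" and s t
  proof -
    obtain u where u: "u \<ge> 0" "t = ennreal u" "u < 1" using t by (cases t) (auto simp: ennreal_less_iff[of _ 1, simplified])
    have "ennreal (u * s) < (SUP x. f x)" using u fs by (auto simp: ennreal_less_iff)
    then obtain x where "ennreal (u * s) < f x" by (auto simp: less_SUP_iff)
    then have "t * ennreal s < f x" using u fs by (simp add: ennreal_mult)
    then have "t < f x / ennreal s"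
      using fs(2) u by (cases "f x") (auto simp: ennreal_mult[symmetric] ennreal_less_iff divide_ennreal ennreal_top_divide pos_less_divide_eq)
    then show ?thesis ..
  qed
  have div: "X / ennreal s = X * ennreal (inverse s)" if "s > 0" for X s
    using that by (simp add: divide_ennreal_def inverse_ennreal)
  have eq: "ennreal s * (?I f / ennreal s) = ?I f" if "s > 0" for s and f :: "real \<Rightarrow> ennreal"
    using that ennreal_mult_divide_eq[of "ennreal s" "?I f"] by (simp add: ennreal_times_divide mult.commute)
  have "?I (\<lambda>x. f x / ennreal a) + ?I (\<lambda>x. g x / ennreal b) \<le> 2 * ?I (\<lambda>x. h x / ennreal c)"
  proof (rule prekopa_leindler_real_normalized)
    fix x y
    have "f x / ennreal a * (g y / ennreal b) = f x * g y * (ennreal (inverse a) * ennreal (inverse b))"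
      by (simp only: div a(2) b(2) mult_ac)
    also have "\<dots> = f x * g y / ennreal (a * b)"
      using a(2) b(2) by (simp add: div ennreal_mult[symmetric])
    also have "\<dots> \<le> (h ((x + y) / 2))\<^sup>2 / ennreal (a * b)"
      using mid by (intro divide_right_mono_ennreal)
    also have "\<dots> = (h ((x + y) / 2))\<^sup>2 * (ennreal (inverse c) * ennreal (inverse c))"
      using c by (simp add: c(2)[symmetric] div ennreal_mult[symmetric])
    also have "\<dots> = (h ((x + y) / 2) / ennreal c)\<^sup>2"
      by (simp only: div c(1) mult_ac power2_eq_square)
    finally show "f x / ennreal a * (g y / ennreal b) \<le> (h ((x + y) / 2) / ennreal c)\<^sup>2" .
  qed (use le1 sup1 a b in auto)
  then have "?I f / ennreal a * (?I g / ennreal b) \<le> (?I h / ennreal c)\<^sup>2"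
    using ennreal_mult_le_square_mean by (simp add: nn_integral_divide)
  then have "ennreal (a * b) * (?I f / ennreal a * (?I g / ennreal b)) \<le> ennreal (c * c) * (?I h / ennreal c)\<^sup>2"
    unfolding c(2) by (intro mult_left_mono) auto
  also have "ennreal (c * c) * (?I h / ennreal c)\<^sup>2 = (ennreal c * (?I h / ennreal c))\<^sup>2"
    using c(1) by (simp add: ennreal_mult power2_eq_square mult_ac)
  also have "ennreal (a * b) * (?I f / ennreal a * (?I g / ennreal b)) = (ennreal a * (?I f / ennreal a)) * (ennreal b * (?I g / ennreal b))"
    using a b by (simp add: ennreal_mult mult_ac)
  finally show ?thesis by (simp only: eq a(2) b(2) c(1))
qed

lemma nn_integral_eq_SUP_truncation:
  fixes f :: "'a \<Rightarrow> ennreal"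
  assumes [measurable]: "f \<in> borel_measurable M"
  shows "(\<integral>\<^sup>+x. f x \<partial>M) = (SUP n. \<integral>\<^sup>+x. min (f x) (of_nat n) \<partial>M)"
proof -
  have "f x = (SUP n. min (f x) (of_nat n))" for x
  proof -
    have "(SUP n. min (f x) (of_nat n)) = inf (f x) (SUP n. of_nat n)"
      by (simp add: inf_min[symmetric] inf_SUP)
    then show ?thesis by (simp add: ennreal_SUP_of_nat_eq_top)
  qed
  then have "(\<integral>\<^sup>+x. f x \<partial>M) = (\<integral>\<^sup>+x. (SUP n. min (f x) (of_nat n)) \<partial>M)"
    by (rule nn_integral_cong)
  also have "\<dots> = (SUP n. \<integral>\<^sup>+x. min (f x) (of_nat n) \<partial>M)"
  proof (rule nn_integral_monotone_convergence_SUP)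
    have "(of_nat m :: ennreal) \<le> of_nat n" if "m \<le> n" for m n using that by simp
    then show "incseq (\<lambda>n x. min (f x) (of_nat n))"
      unfolding incseq_def le_fun_def by (metis min.mono order_refl)
  qed measurable
  finally show ?thesis .
qed

text \<open>Cutting \<open>f\<close> and \<open>g\<close> off at independent heights preserves the
  midpoint hypothesis; the supremum over both heights removes the boundedness assumption.\<close>

lemma prekopa_leindler_real:
  fixes f g h :: "real \<Rightarrow> ennreal"
  assumes meas[measurable]: "f \<in> borel_measurable borel" "g \<in> borel_measurable borel" "h \<in> borel_measurable borel"
    and mid: "\<And>x y. f x * g y \<le> (h ((x + y) / 2))\<^sup>2"
  shows "(\<integral>\<^sup>+x. f x \<partial>lborel) * (\<integral>\<^sup>+x. g x \<partial>lborel) \<le> (\<integral>\<^sup>+x. h x \<partial>lborel)\<^sup>2"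
proof -
  let ?T = "\<lambda>f n. \<integral>\<^sup>+x. min (f x) (of_nat n) \<partial>lborel"
  have "?T f m * ?T g n \<le> (\<integral>\<^sup>+x. h x \<partial>lborel)\<^sup>2" for m n :: nat
  proof (rule prekopa_leindler_real_bounded)
    show "min (f x) (of_nat m) \<le> ennreal (real m)" "min (g x) (of_nat n) \<le> ennreal (real n)" for x
      by (simp_all add: ennreal_of_nat_eq_real_of_nat)
    show "min (f x) (of_nat m) * min (g y) (of_nat n) \<le> (h ((x + y) / 2))\<^sup>2" for x y
      by (rule order_trans[OF mult_mono mid]) auto
  qed measurable
  then have "(SUP m. SUP n. ?T f m * ?T g n) \<le> (\<integral>\<^sup>+x. h x \<partial>lborel)\<^sup>2"
    by (intro SUP_least)
  also have "(SUP m. SUP n. ?T f m * ?T g n) = (SUP m. ?T f m) * (SUP n. ?T g n)"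
    by (simp only: SUP_mult_left_ennreal[symmetric] SUP_mult_right_ennreal[symmetric])
  finally show ?thesis
    using meas(1,2)[THEN nn_integral_eq_SUP_truncation[of _ lborel, simplified]] by simp
qed

section \<open>Passage from the line to finite products\<close>

lemma product_sigma_finite_lborel: "product_sigma_finite (\<lambda>_. lborel :: real measure)"
  by standard

lemma borel_measurable_PiM_slice:
  assumes "f \<in> borel_measurable (PiM (insert i I) (\<lambda>_. lborel :: real measure))" "i \<notin> I" "x \<in> extensional I"
  shows "(\<lambda>a. f (x(i := a))) \<in> borel_measurable borel"
  using measurable_comp[OF measurable_component_update[of x I "\<lambda>_. lborel" i] assms(1)] assms(2,3)
  by (simp add: comp_def space_PiM PiE_UNIV_domain PiE_def)

lemma borel_measurable_nn_integral_PiM_slice: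
  assumes "f \<in> borel_measurable (PiM (insert i I) (\<lambda>_. lborel :: real measure))"
  shows "(\<lambda>x. \<integral>\<^sup>+a. f (x(i := a)) \<partial>lborel) \<in> borel_measurable (PiM I (\<lambda>_. lborel))"
  using measurable_compose[OF measurable_add_dim assms]
  by (intro lborel.borel_measurable_nn_integral) (simp add: case_prod_beta')

text \<open>Induction over the coordinates: by the inequality on the line, the integrals over one
  coordinate again satisfy the midpoint hypothesis in the remaining coordinates.\<close>

lemma prekopa_leindler_PiM:
  fixes f g h :: "('i \<Rightarrow> real) \<Rightarrow> ennreal"
  assumes "finite I"
    and "f \<in> borel_measurable (PiM I (\<lambda>_. lborel))" "g \<in> borel_measurable (PiM I (\<lambda>_. lborel))"
      "h \<in> borel_measurable (PiM I (\<lambda>_. lborel))"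
    and "\<And>x y. x \<in> extensional I \<Longrightarrow> y \<in> extensional I \<Longrightarrow> f x * g y \<le> (h (\<lambda>i\<in>I. (x i + y i) / 2))\<^sup>2"
  shows "(\<integral>\<^sup>+x. f x \<partial>PiM I (\<lambda>_. lborel)) * (\<integral>\<^sup>+x. g x \<partial>PiM I (\<lambda>_. lborel)) \<le> (\<integral>\<^sup>+x. h x \<partial>PiM I (\<lambda>_. lborel))\<^sup>2"
  using assms
proof (induction I arbitrary: f g h rule: finite_induct)
  case empty
  interpret product_sigma_finite "\<lambda>_. lborel :: real measure" by (rule product_sigma_finite_lborel)
  from empty.prems(4)[of "\<lambda>_. undefined" "\<lambda>_. undefined"] show ?case
    by (simp add: nn_integral_empty restrict_def)
next
  case (insert i I)
  interpret product_sigma_finite "\<lambda>_. lborel :: real measure" by (rule product_sigma_finite_lborel)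
  let ?J = "\<lambda>f x. \<integral>\<^sup>+a. f (x(i := a)) \<partial>lborel"
  have "(\<integral>\<^sup>+x. ?J f x \<partial>PiM I (\<lambda>_. lborel)) * (\<integral>\<^sup>+x. ?J g x \<partial>PiM I (\<lambda>_. lborel)) \<le> (\<integral>\<^sup>+x. ?J h x \<partial>PiM I (\<lambda>_. lborel))\<^sup>2"
  proof (rule insert.IH)
    fix x y :: "'i \<Rightarrow> real" assume xy: "x \<in> extensional I" "y \<in> extensional I"
    show "?J f x * ?J g y \<le> (?J h (\<lambda>i\<in>I. (x i + y i) / 2))\<^sup>2"
    proof (rule prekopa_leindler_real)
      fix a b :: real
      have ext: "x(i := a) \<in> extensional (insert i I)" "y(i := b) \<in> extensional (insert i I)"
        using xy by (auto simp: extensional_def)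
      have eq: "(\<lambda>j\<in>insert i I. ((x(i := a)) j + (y(i := b)) j) / 2) = (\<lambda>i\<in>I. (x i + y i) / 2)(i := (a + b) / 2)"
        using insert.hyps(2) by (auto simp: fun_eq_iff restrict_def)
      show "f (x(i := a)) * g (y(i := b)) \<le> (h ((\<lambda>i\<in>I. (x i + y i) / 2)(i := (a + b) / 2)))\<^sup>2"
        using insert.prems(4)[OF ext] unfolding eq .
    qed (rule borel_measurable_PiM_slice insert.prems insert.hyps xy restrict_extensional)+
  qed (rule borel_measurable_nn_integral_PiM_slice insert.prems)+
  then show ?case
    using insert.hyps insert.prems by (simp add: product_nn_integral_insert)
qed

section \<open>Distributions with log-concave distribution function\<close>

text \<open>Monotonicity bounds the deviation \<open>D\<close> from the chord, and this boundedness
  takes the place of continuity in the step from midpoint convexity to convexity.\<close>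

lemma convex_on_midpoint_antimono:
  fixes g :: "real \<Rightarrow> real"
  assumes S: "convex S"
    and mid: "\<And>x y. x \<in> S \<Longrightarrow> y \<in> S \<Longrightarrow> g ((x + y) / 2) \<le> (g x + g y) / 2"
    and anti: "\<And>x y. x \<in> S \<Longrightarrow> y \<in> S \<Longrightarrow> x \<le> y \<Longrightarrow> g y \<le> g x"
  shows "convex_on S g"
proof (rule convex_on_linorderI)
  fix t0 x y :: real
  assume t0: "0 < t0" "t0 < 1" and xy: "x \<in> S" "y \<in> S" "x < y"
  define z where "z t = (1 - t) * x + t * y" for t
  define D where "D t = g (z t) - (1 - t) * g x - t * g y" for t
  define m where "m = (SUP t\<in>{0..1}. D t)"
  have z_in: "z t \<in> S" if "t \<in> {0..1}" for t
    using convexD_alt[OF S xy(1,2), of t] that by (simp add: z_def)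
  have z_bounds: "x \<le> z t" "z t \<le> y" if "t \<in> {0..1}" for t
  proof -
    have "0 \<le> t * (y - x)" "0 \<le> (1 - t) * (y - x)" using that xy by auto
    then show "x \<le> z t" "z t \<le> y" by (auto simp: z_def algebra_simps)
  qed
  have "D t \<le> g x - g y" if "t \<in> {0..1}" for t
  proof -
    have "g (z t) \<le> g x" using anti[OF xy(1) z_in[OF that]] z_bounds[OF that] by simp
    moreover have "0 \<le> (1 - t) * (g x - g y)" using anti[OF xy(1,2)] that xy(3) by auto
    ultimately show ?thesis by (simp add: D_def algebra_simps)
  qed
  then have bdd: "bdd_above (D ` {0..1})" by (rule bdd_aboveI2)
  have D_le: "D t \<le> m" if "t \<in> {0..1}" for t
    unfolding m_def by (rule cSUP_upper[OF that bdd])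
  \<comment> \<open>\<open>z t\<close> is the midpoint of the nearer endpoint, where the deviation
    vanishes, and another point of the segment. Hence the supremum satisfies
    \<open>m \<le> m / 2\<close> and cannot be positive.\<close>
  have half: "D t \<le> m / 2" if t: "t \<in> {0..1}" for t
  proof (cases "t \<le> 1 / 2")
    case True
    then have t': "2 * t \<in> {0..1}" using t by auto
    have eq: "(x + z (2 * t)) / 2 = z t" by (simp add: z_def field_simps)
    have "g (z t) \<le> (g x + g (z (2 * t))) / 2" using mid[OF xy(1) z_in[OF t']] unfolding eq .
    then have "D t \<le> D (2 * t) / 2" by (simp add: D_def field_simps)
    then show ?thesis using D_le[OF t'] by simp
  next
    case False
    then have t': "2 * t - 1 \<in> {0..1}" using t by auto
    have eq: "(z (2 * t - 1) + y) / 2 = z t" by (simp add: z_def field_simps)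
    have "g (z t) \<le> (g (z (2 * t - 1)) + g y) / 2" using mid[OF z_in[OF t'] xy(2)] unfolding eq .
    then have "D t \<le> D (2 * t - 1) / 2" by (simp add: D_def field_simps)
    then show ?thesis using D_le[OF t'] by simp
  qed
  have "m \<le> m / 2" unfolding m_def by (rule cSUP_least) (use half m_def in auto)
  then have "D t0 \<le> 0" using D_le[of t0] t0 by auto
  then show "g ((1 - t0) *\<^sub>R x + t0 *\<^sub>R y) \<le> (1 - t0) * g x + t0 * g y"
    by (simp add: D_def z_def)
qed (rule S)

section \<open>A distribution function evaluated under its own law\<close>

context real_distribution
begin

lemma borel_measurable_cdf [measurable]: "cdf M \<in> borel_measurable borel"
  by (rule borel_measurable_mono) (auto simp: mono_def intro: finite_borel_measure.cdf_nondecreasing[OF finite_borel_measure_M])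

lemma prob_UNIV [simp]: "prob UNIV = 1"
  using prob_space by simp

lemma cdf_mono: "x \<le> y \<Longrightarrow> cdf M x \<le> cdf M y"
  by (rule finite_borel_measure.cdf_nondecreasing[OF finite_borel_measure_M])

lemma cdf_ge_0: "0 \<le> cdf M x"
  by (rule finite_borel_measure.cdf_nonneg[OF finite_borel_measure_M])

text \<open>Up to any \<open>a\<close> in the set, the mass is at most
  \<open>cdf M a \<le> u\<close>. This is the half of the uniformity of \<open>cdf M x\<close> that
  survives atoms.\<close>

lemma emeasure_cdf_le:
  assumes "0 \<le> u"
  shows "emeasure M {x. cdf M x \<le> u} \<le> ennreal u"
proof (cases "{x. cdf M x \<le> u} = {}")
  case False
  have "0 + emeasure M {x. cdf M x \<le> u} \<le> ennreal u"
  proof (rule emeasure_le_initial_segments)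
    fix a assume a: "a \<in> {x. cdf M x \<le> u}"
    have "emeasure M ({x. cdf M x \<le> u} \<inter> {..a}) \<le> emeasure M {..a}"
      by (intro emeasure_mono) auto
    also have "\<dots> = ennreal (cdf M a)" by (simp add: emeasure_eq_measure cdf_def)
    also have "\<dots> \<le> ennreal u" using a by (simp add: ennreal_leI)
    finally show "0 + emeasure M ({x. cdf M x \<le> u} \<inter> {..a}) \<le> ennreal u" by simp
  qed (use False in auto)
  then show ?thesis by simp
qed simp

text \<open>For an exactly uniform \<open>cdf M x\<close> the value would be \<open>1\<close>. A
  dyadic count costs slightly more: \<open>- ln (cdf M x)\<close> is at most \<open>ln 2\<close>
  times the number of \<open>k\<close> with \<open>cdf M x \<le> (1 / 2) ^ k\<close>, and these
  events have geometrically decreasing masses.\<close>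

lemma nn_integral_neg_ln_cdf: "(\<integral>\<^sup>+x. ennreal (- ln (cdf M x)) \<partial>M) \<le> ennreal (2 * ln 2)"
proof -
  let ?A = "\<lambda>k::nat. {x. cdf M x \<le> (1 / 2) ^ k}"
  have pointwise: "ennreal (- ln (cdf M x)) \<le> (\<Sum>k. ennreal (ln 2) * indicator (?A k) x)" for x
  \<comment> \<open>Where the distribution function vanishes, the convention \<open>ln 0 = 0\<close>
    makes the left side zero.\<close>
  proof (cases "cdf M x = 0")
    case False
    then have pos: "cdf M x > 0" using cdf_ge_0[of x] by simp
    define y where "y = - ln (cdf M x) / ln 2"
    have y0: "y \<ge> 0" unfolding y_def using pos cdf_bounded_prob[of x] by (intro divide_nonneg_pos) auto
    define n where "n = nat \<lfloor>y\<rfloor>"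
    have n: "real n \<le> y" "y \<le> real n + 1" using y0 unfolding n_def by linarith+
    have "x \<in> ?A k" if "k \<le> n" for k
    proof -
      have "real k \<le> y" using that n by linarith
      then have "real k * ln 2 \<le> - ln (cdf M x)" unfolding y_def by (subst (asm) pos_le_divide_eq) auto
      then have "ln (cdf M x) \<le> ln ((1 / 2) ^ k)" by (simp add: ln_realpow ln_div)
      then show ?thesis using pos by simp
    qed
    then have "(\<Sum>k\<in>{..n}. ennreal (ln 2) * indicator (?A k) x) = (\<Sum>k\<in>{..n}. ennreal (ln 2))"
      by (intro sum.cong) auto
    also have "\<dots> = ennreal (\<Sum>k\<in>{..n}. ln 2)" by (rule sum_ennreal) simp
    also have "(\<Sum>k\<in>{..n}. ln 2) = (real n + 1) * ln (2::real)" by simp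
    finally have eq: "(\<Sum>k\<in>{..n}. ennreal (ln 2) * indicator (?A k) x) = ennreal ((real n + 1) * ln 2)" .
    have "- ln (cdf M x) = y * ln 2" by (simp add: y_def)
    also have "\<dots> \<le> (real n + 1) * ln 2" using n by (intro mult_right_mono) auto
    finally have "ennreal (- ln (cdf M x)) \<le> (\<Sum>k\<in>{..n}. ennreal (ln 2) * indicator (?A k) x)"
      unfolding eq by (rule ennreal_leI)
    also have "\<dots> \<le> (\<Sum>k. ennreal (ln 2) * indicator (?A k) x)"
      by (intro sum_le_suminf) auto
    finally show ?thesis .
  qed simp
  have "(\<integral>\<^sup>+x. ennreal (- ln (cdf M x)) \<partial>M) \<le> (\<integral>\<^sup>+x. (\<Sum>k. ennreal (ln 2) * indicator (?A k) x) \<partial>M)"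
    using pointwise by (intro nn_integral_mono)
  also have "\<dots> = (\<Sum>k. \<integral>\<^sup>+x. ennreal (ln 2) * indicator (?A k) x \<partial>M)"
    by (intro nn_integral_suminf) measurable
  also have "\<dots> = (\<Sum>k. ennreal (ln 2) * emeasure M (?A k))"
    by (intro suminf_cong nn_integral_cmult_indicator) measurable
  also have "\<dots> \<le> (\<Sum>k. ennreal (ln 2 * (1 / 2) ^ k))"
  proof (intro suminf_le summableI)
    fix k show "ennreal (ln 2) * emeasure M (?A k) \<le> ennreal (ln 2 * (1 / 2) ^ k)"
      using emeasure_cdf_le[of "(1 / 2) ^ k"] by (subst ennreal_mult) (auto intro!: mult_left_mono)
  qed
  also have "\<dots> = ennreal (\<Sum>k. ln 2 * (1 / 2) ^ k)"
    by (intro suminf_ennreal2) (auto intro!: summable_mult summable_geometric)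
  also have "(\<Sum>k. ln 2 * (1 / 2) ^ k) = 2 * ln (2::real)"
    by (subst suminf_mult) (auto simp: suminf_geometric summable_geometric)
  finally show ?thesis .
qed

lemma AE_cdf_pos: "AE x in M. cdf M x > 0"
proof -
  have "emeasure M {x. cdf M x \<le> 0} = 0" using emeasure_cdf_le[of 0] by simp
  then have "{x. \<not> cdf M x > 0} \<in> null_sets M" by (simp add: not_less null_sets_def)
  then show ?thesis by (auto simp: eventually_ae_filter intro!: bexI[of _ "{x. \<not> cdf M x > 0}"])
qed

text \<open>Jensen's inequality for the convex function \<open>- ln \<circ> cdf M\<close>: since \<open>cdf M\<close>
  stochastically dominates a uniform variable, the mean of \<open>- ln (cdf M x)\<close> is at most an absolute constant.\<close>

lemma cdf_truncated_mean:
  assumes lc: "\<And>x y. cdf M x * cdf M y \<le> (cdf M ((x + y) / 2))\<^sup>2"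
    and int: "integrable M (\<lambda>x. x)" and pos: "cdf M m > 0"
  shows "cdf M m / 4 \<le> cdf M (expectation (\<lambda>x. min x m))"
proof -
  define \<mu> where "\<mu> = expectation (\<lambda>x. min x m)"
  let ?I = "{x. cdf M x > 0}"
  let ?L = "\<lambda>x. - ln (cdf M x)"
  have int_min[simp]: "integrable M (\<lambda>x. min x m)" using int by simp
  have "\<mu> \<le> expectation (\<lambda>x. m)" unfolding \<mu>_def by (intro integral_mono) auto
  then have \<mu>_le: "\<mu> \<le> m" by simp
  have L_nonneg: "?L x \<ge> 0" if "cdf M x > 0" for x
    using that cdf_bounded_prob[of x] by simp
  show ?thesis
  \<comment> \<open>In the first case \<open>\<mu>\<close> is interior to \<open>?I\<close>, which
    gives the convex function \<open>?L\<close> a supporting line there; its slope \<open>k\<close>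
    is what Jensen's inequality needs.\<close>
  proof (cases "\<exists>y<\<mu>. cdf M y > 0")
    case True
    then obtain y where y: "y < \<mu>" "cdf M y > 0" by blast
    have "convex_on ?I ?L"
    proof (rule convex_on_midpoint_antimono)
      have "is_interval ?I"
        unfolding is_interval_1 using cdf_mono by (auto intro: less_le_trans)
      then show "convex ?I" by (simp add: is_interval_convex_1)
    next
      fix x y assume xy: "x \<in> ?I" "y \<in> ?I"
      then have p: "0 < cdf M x * cdf M y" by simp
      then have "cdf M ((x + y) / 2) \<noteq> 0" using lc[of x y] by auto
      then have q: "cdf M ((x + y) / 2) > 0" using cdf_ge_0[of "(x + y) / 2"] by simp
      have "ln (cdf M x * cdf M y) \<le> ln ((cdf M ((x + y) / 2))\<^sup>2)"
        using lc[of x y] p q by (subst ln_le_cancel_iff) auto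
      then have "ln (cdf M x) + ln (cdf M y) \<le> 2 * ln (cdf M ((x + y) / 2))"
        using xy q by (simp add: ln_mult ln_realpow)
      then show "?L ((x + y) / 2) \<le> (?L x + ?L y) / 2" by simp
    next
      fix x y assume "x \<in> ?I" "y \<in> ?I" "x \<le> y"
      then show "?L y \<le> ?L x" using cdf_mono[of x y] by simp
    qed
    moreover have "\<mu> \<in> interior ?I"
    proof (rule interiorI)
      show "open {y<..}" "\<mu> \<in> {y<..}" using y by auto
      show "{y<..} \<subseteq> ?I" using y(2) cdf_mono by (auto intro: less_le_trans)
    qed
    ultimately obtain k where k: "\<And>x. x \<in> ?I \<Longrightarrow> ?L x \<ge> ?L \<mu> + k * (x - \<mu>)"
      using convex_le_Inf_differential by blast
    have \<mu>_pos: "cdf M \<mu> > 0" using y cdf_mono[of y \<mu>] by simp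
    have intL: "integrable M ?L"
    proof (rule integrableI_nonneg)
      show "AE x in M. 0 \<le> ?L x" using AE_cdf_pos by eventually_elim (rule L_nonneg)
      show "(\<integral>\<^sup>+x. ennreal (?L x) \<partial>M) < \<infinity>" using nn_integral_neg_ln_cdf by (rule le_less_trans) simp
    qed measurable
    have "expectation ?L \<le> 2 * ln 2"
    proof -
      have "ennreal (expectation ?L) = (\<integral>\<^sup>+x. ennreal (?L x) \<partial>M)"
        using AE_cdf_pos intL by (intro nn_integral_eq_integral[symmetric]) (auto elim!: eventually_mono simp: cdf_bounded_prob)
      then have "ennreal (expectation ?L) \<le> ennreal (2 * ln 2)" using nn_integral_neg_ln_cdf by simp
      then show ?thesis by (subst (asm) ennreal_le_iff) auto
    qed
    moreover have "?L \<mu> \<le> expectation ?L + ?L m"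
    proof -
      have "?L \<mu> = expectation (\<lambda>x. ?L \<mu> + k * (min x m - \<mu>))"
        by (simp add: \<mu>_def)
      also have "\<dots> \<le> expectation (\<lambda>x. ?L x + ?L m)"
      proof (rule integral_mono_AE)
        show "AE x in M. ?L \<mu> + k * (min x m - \<mu>) \<le> ?L x + ?L m"
          using AE_cdf_pos
        proof eventually_elim
          fix x assume x: "cdf M x > 0"
          then have "?L \<mu> + k * (min x m - \<mu>) \<le> ?L (min x m)"
            using pos by (intro k) (auto simp: min_def)
          \<comment> \<open>\<open>min x m\<close> is one of \<open>x\<close> and \<open>m\<close>,
            and both terms are nonnegative. In the mean, \<open>?L x\<close> costs at most
            \<open>2 * ln 2\<close>, whence the factor \<open>1 / 4\<close>.\<close>
          also have "\<dots> \<le> ?L x + ?L m" using L_nonneg[OF x] L_nonneg[OF pos] by (auto simp: min_def)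
          finally show "?L \<mu> + k * (min x m - \<mu>) \<le> ?L x + ?L m" .
        qed
      qed (use intL in auto)
      also have "\<dots> = expectation ?L + ?L m" using intL by simp
      finally show ?thesis .
    qed
    ultimately have "ln (cdf M m) - 2 * ln 2 \<le> ln (cdf M \<mu>)" by simp
    moreover have "ln (cdf M m / 4) = ln (cdf M m) - 2 * ln 2"
      using pos ln_realpow[of 2 2] by (simp add: ln_div)
    ultimately have "ln (cdf M m / 4) \<le> ln (cdf M \<mu>)" by simp
    then show ?thesis using pos \<mu>_pos unfolding \<mu>_def by simp
  next
    case False
    \<comment> \<open>No mass lies below \<open>\<mu>\<close>, so \<open>min x m\<close> equals its
      mean almost everywhere. Then either \<open>\<mu> = m\<close>, or all mass lies in
      \<open>{..\<mu>}\<close>.\<close>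
    have "AE x in M. \<mu> \<le> x" using AE_cdf_pos by eventually_elim (use False in force)
    then have ge: "AE x in M. 0 \<le> min x m - \<mu>" by eventually_elim (use \<mu>_le in auto)
    have "expectation (\<lambda>x. min x m - \<mu>) = 0" by (simp add: \<mu>_def)
    then have eq: "AE x in M. min x m - \<mu> = 0"
      using integral_nonneg_eq_0_iff_AE[OF _ ge] by simp
    show ?thesis
    proof (cases "\<mu> = m")
      case True
      then show ?thesis using pos unfolding \<mu>_def by simp
    next
      case False
      have "AE x in M. x \<in> {..\<mu>}"
        using eq by eventually_elim (use False \<mu>_le in \<open>auto simp: min_def split: if_splits\<close>)
      then have "cdf M \<mu> = 1" unfolding cdf_def by (subst prob_eq_1) auto
      then show ?thesis using cdf_bounded_prob[of m] pos unfolding \<mu>_def by simp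
    qed
  qed
qed

text \<open>Truncating at \<open>R\<close> keeps the mean at zero and yields \<open>1 / 4\<close> at
  \<open>0\<close>. Truncating at \<open>0\<close> moves the mean to minus the mean positive part
  and costs a second factor \<open>4\<close>.\<close>

lemma cdf_neg_mean_positive_part:
  assumes lc: "\<And>x y. cdf M x * cdf M y \<le> (cdf M ((x + y) / 2))\<^sup>2"
    and bounded: "AE x in M. x \<le> R" and int: "integrable M (\<lambda>x. x)" and mean: "expectation (\<lambda>x. x) = 0"
  shows "1 / 16 \<le> cdf M (- expectation (\<lambda>x. max x 0))"
proof -
  have "AE x in M. x \<in> {..R}" using bounded by auto
  then have R: "cdf M R = 1" unfolding cdf_def by (subst prob_eq_1) auto
  have "expectation (\<lambda>x. min x R) = expectation (\<lambda>x. x)"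
    using bounded by (intro integral_cong_AE) (auto elim!: eventually_mono)
  then have zero: "1 / 4 \<le> cdf M 0" using cdf_truncated_mean[OF lc int, of R] R mean by simp
  have "expectation (\<lambda>x. min x 0) = expectation (\<lambda>x. x - max x 0)"
    by (intro Bochner_Integration.integral_cong) auto
  also have "\<dots> = - expectation (\<lambda>x. max x 0)" using int mean by simp
  finally show ?thesis using cdf_truncated_mean[OF lc int, of 0] zero by simp
qed

end

section \<open>Volume and convexity in coordinates\<close>

text \<open>Each coordinate contributes one factor \<open>c\<close> by substitution on the
  line.\<close>

lemma nn_integral_PiM_affine:
  fixes f :: "('i \<Rightarrow> real) \<Rightarrow> ennreal" and c :: real
  assumes "finite I" "f \<in> borel_measurable (PiM I (\<lambda>_. lborel))" "c > 0"
  shows "(\<integral>\<^sup>+x. f x \<partial>PiM I (\<lambda>_. lborel))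
    = ennreal (c ^ card I) * (\<integral>\<^sup>+x. f (\<lambda>i\<in>I. t i + c * x i) \<partial>PiM I (\<lambda>_. lborel))"
  using assms(1,2)
proof (induction I arbitrary: f rule: finite_induct)
  case empty
  interpret product_sigma_finite "\<lambda>_. lborel :: real measure" by (rule product_sigma_finite_lborel)
  show ?case by (simp add: nn_integral_empty restrict_def space_PiM)
next
  case (insert i I)
  interpret product_sigma_finite "\<lambda>_. lborel :: real measure" by (rule product_sigma_finite_lborel)
  let ?M = "\<lambda>I. PiM I (\<lambda>_. lborel :: real measure)"
  let ?A = "\<lambda>I x. \<lambda>i\<in>I. t i + c * x i"
  have aff[measurable]: "?A I \<in> measurable (?M I) (?M I)" for I :: "'i set"
    by measurable
  have fA: "(\<lambda>x. f (?A (insert i I) x)) \<in> borel_measurable (?M (insert i I))"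
    by (rule measurable_compose[OF aff insert.prems])
  have slice: "(\<integral>\<^sup>+a. f ((?A I x)(i := a)) \<partial>lborel) = ennreal c * (\<integral>\<^sup>+a. f (?A (insert i I) (x(i := a))) \<partial>lborel)" for x
  proof -
    have eq: "(?A I x)(i := t i + c * a) = ?A (insert i I) (x(i := a))" for a
      using insert.hyps by (auto simp: fun_eq_iff restrict_def)
    have "(\<integral>\<^sup>+a. f ((?A I x)(i := a)) \<partial>lborel) = ennreal \<bar>c\<bar> * (\<integral>\<^sup>+a. f ((?A I x)(i := t i + c * a)) \<partial>lborel)"
      using assms(3) insert.hyps by (intro nn_integral_real_affine borel_measurable_PiM_slice[OF insert.prems]) auto
    then show ?thesis using assms(3) by (simp only: eq abs_of_pos)
  qed
  have "(\<integral>\<^sup>+x. f x \<partial>?M (insert i I)) = (\<integral>\<^sup>+x. (\<integral>\<^sup>+a. f (x(i := a)) \<partial>lborel) \<partial>?M I)"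
    by (rule product_nn_integral_insert[OF insert.hyps insert.prems])
  also have "\<dots> = ennreal (c ^ card I) * (\<integral>\<^sup>+x. (\<integral>\<^sup>+a. f ((?A I x)(i := a)) \<partial>lborel) \<partial>?M I)"
    by (rule insert.IH[OF borel_measurable_nn_integral_PiM_slice[OF insert.prems]])
  also have "\<dots> = ennreal (c ^ card I) * (\<integral>\<^sup>+x. ennreal c * (\<integral>\<^sup>+a. f (?A (insert i I) (x(i := a))) \<partial>lborel) \<partial>?M I)"
    by (simp only: slice)
  also have "\<dots> = ennreal (c ^ card I) * (ennreal c * (\<integral>\<^sup>+x. (\<integral>\<^sup>+a. f (?A (insert i I) (x(i := a))) \<partial>lborel) \<partial>?M I))"
    by (subst nn_integral_cmult[OF borel_measurable_nn_integral_PiM_slice[OF fA]]) (rule refl)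
  also have "\<dots> = ennreal (c ^ card (insert i I)) * (\<integral>\<^sup>+x. f (?A (insert i I) x) \<partial>?M (insert i I))"
    using insert.hyps assms(3)
    by (simp only: product_nn_integral_insert[OF insert.hyps fA]) (simp add: ennreal_mult mult_ac)
  finally show ?case .
qed

lemma space_lebd [simp]: "space (lebd d) = Rd d"
  by (simp add: lebd_def space_PiM Rd_def)

lemma measurable_lebd_component [measurable]: "i < d \<Longrightarrow> (\<lambda>x. x i) \<in> borel_measurable (lebd d)"
  using measurable_component_singleton[of i "{..<d}" "\<lambda>_. lborel :: real measure"]
  by (simp add: lebd_def)

lemma borel_measurable_ip [measurable]: "(\<lambda>x. ip d x v) \<in> borel_measurable (lebd d)"
  unfolding ip_def by (intro borel_measurable_sum borel_measurable_times measurable_lebd_component borel_measurable_const) simp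

lemma nn_integral_lebd_affine:
  assumes "f \<in> borel_measurable (lebd d)" "c > 0"
  shows "(\<integral>\<^sup>+x. f x \<partial>lebd d) = ennreal (c ^ d) * (\<integral>\<^sup>+x. f (vadd d t (vscale d c x)) \<partial>lebd d)"
proof -
  have "vadd d t (vscale d c x) = (\<lambda>i\<in>{..<d}. t i + c * x i)" for x
    by (auto simp: vadd_def vscale_def fun_eq_iff)
  then show ?thesis
    using nn_integral_PiM_affine[of "{..<d}" f c t] assms by (simp add: lebd_def)
qed

lemma measurable_vadd_vscale [measurable]: "(\<lambda>x. vadd d t (vscale d c x)) \<in> measurable (lebd d) (lebd d)"
proof -
  have "vadd d t (vscale d c x) = (\<lambda>i\<in>{..<d}. t i + c * x i)" for x
    by (auto simp: vadd_def vscale_def fun_eq_iff)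
  then show ?thesis unfolding lebd_def by simp
qed

lemma emeasure_lebd_affine:
  assumes "A \<in> sets (lebd d)" "c > 0"
  shows "emeasure (lebd d) A = ennreal (c ^ d) * emeasure (lebd d) {x \<in> Rd d. vadd d t (vscale d c x) \<in> A}"
proof -
  have m: "{x \<in> Rd d. vadd d t (vscale d c x) \<in> A} \<in> sets (lebd d)"
    using measurable_sets[OF measurable_vadd_vscale assms(1), of t c] by (simp add: vimage_def Int_def conj_commute)
  have "emeasure (lebd d) A = (\<integral>\<^sup>+x. indicator A x \<partial>lebd d)" using assms by simp
  also have "\<dots> = ennreal (c ^ d) * (\<integral>\<^sup>+x. indicator A (vadd d t (vscale d c x)) \<partial>lebd d)"
    using assms by (intro nn_integral_lebd_affine) auto
  also have "(\<integral>\<^sup>+x. indicator A (vadd d t (vscale d c x)) \<partial>lebd d) = (\<integral>\<^sup>+x. indicator {x \<in> Rd d. vadd d t (vscale d c x) \<in> A} x \<partial>lebd d)"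
    by (intro nn_integral_cong) (auto simp: indicator_def)
  finally show ?thesis using m by simp
qed

section \<open>Euclidean norm and inner product\<close>

lemma nrm_eq_L2_set: "nrm d x = L2_set x {..<d}"
  by (simp add: nrm_def ip_def L2_set_def power2_eq_square)

lemma nrm_nonneg: "0 \<le> nrm d x"
  by (simp add: nrm_eq_L2_set)

lemma nrm_vadd: "nrm d (vadd d x y) \<le> nrm d x + nrm d y"
proof -
  have "L2_set (vadd d x y) {..<d} = L2_set (\<lambda>i. x i + y i) {..<d}"
    by (intro L2_set_cong) (auto simp: vadd_def)
  then show ?thesis by (simp add: nrm_eq_L2_set L2_set_triangle_ineq)
qed

lemma nrm_vscale: "nrm d (vscale d c x) = \<bar>c\<bar> * nrm d x"
proof -
  have "L2_set (vscale d c x) {..<d} = sqrt (\<Sum>i<d. c\<^sup>2 * (x i)\<^sup>2)"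
    unfolding L2_set_def by (intro arg_cong[where f = sqrt] sum.cong) (auto simp: vscale_def power_mult_distrib)
  also have "\<dots> = \<bar>c\<bar> * L2_set x {..<d}"
    by (simp add: L2_set_def sum_distrib_left[symmetric] real_sqrt_mult)
  finally show ?thesis by (simp add: nrm_eq_L2_set)
qed

lemma abs_ip_le: "\<bar>ip d x y\<bar> \<le> nrm d x * nrm d y"
proof -
  have "\<bar>ip d x y\<bar> \<le> (\<Sum>i<d. \<bar>x i\<bar> * \<bar>y i\<bar>)"
    unfolding ip_def by (rule order_trans[OF sum_abs]) (simp add: abs_mult)
  then show ?thesis using L2_set_mult_ineq[of x y "{..<d}"] by (simp add: nrm_eq_L2_set)
qed

lemma abs_component_le_nrm: "i < d \<Longrightarrow> \<bar>x i\<bar> \<le> nrm d x"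
  using member_le_L2_set[of "{..<d}" i "\<lambda>i. \<bar>x i\<bar>"] by (simp add: nrm_eq_L2_set L2_set_def)

lemma ip_vadd: "ip d (vadd d x y) v = ip d x v + ip d y v"
  by (simp add: ip_def vadd_def distrib_right sum.distrib)

lemma ip_vscale: "ip d (vscale d c x) v = c * ip d x v"
  by (simp add: ip_def vscale_def sum_distrib_left mult.assoc)

lemma vadd_in_Rd [simp]: "vadd d x y \<in> Rd d" and vscale_in_Rd [simp]: "vscale d c x \<in> Rd d"
  by (simp_all add: vadd_def vscale_def Rd_def)

text \<open>Measurability of Minkowski sums is obtained through compactness, which they inherit. The
  identity is measurable from \<open>lebd d\<close> into the Borel sets of the product topology,
  coordinate by coordinate.\<close>

lemma compact_imp_sets_lebd:
  assumes "compact S" "S \<subseteq> Rd d"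
  shows "S \<in> sets (lebd d)"
proof -
  have "(\<lambda>x. x) \<in> borel_measurable (lebd d)"
  proof (rule measurable_coordinatewise_then_product)
    fix i
    show "(\<lambda>x. x i) \<in> borel_measurable (lebd d)"
    proof (cases "i < d")
      case False
      \<comment> \<open>Points of \<open>Rd d\<close> are constantly \<open>undefined\<close> in the
        coordinates from \<open>d\<close> on.\<close>
      then have "(\<lambda>x. x i) \<in> borel_measurable (lebd d) \<longleftrightarrow> (\<lambda>x. undefined :: real) \<in> borel_measurable (lebd d)"
        by (intro measurable_cong) (auto simp: Rd_def PiE_def extensional_def)
      then show ?thesis by simp
    qed measurable
  qed
  then have "(\<lambda>x. x) -` S \<inter> space (lebd d) \<in> sets (lebd d)"
    by (rule measurable_sets) (simp add: assms(1) borel_closed compact_imp_closed)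
  also have "(\<lambda>x. x) -` S \<inter> space (lebd d) = S" using assms(2) by auto
  finally show ?thesis .
qed

section \<open>Compactness of balls and of Minkowski sums\<close>

lemma continuous_on_ip: "continuous_on S (\<lambda>x. ip d x v)"
  unfolding ip_def by (intro continuous_intros continuous_on_subset[OF continuous_on_product_coordinates]) auto

lemma continuous_on_nrm: "continuous_on S (nrm d)"
  unfolding nrm_def ip_def by (intro continuous_intros continuous_on_subset[OF continuous_on_product_coordinates]) auto

text \<open>By Tychonoff's theorem: the ball is a closed part of a product of compact factors, where
  the coordinates from \<open>d\<close> on are pinned to \<open>undefined\<close>.\<close>

lemma compact_unitball: "compact (unitball d)"
proof -
  let ?B = "PiE UNIV (\<lambda>i. if i < d then {-1..1} else {undefined :: real})"
  have "compactin (product_topology (\<lambda>_. euclidean) UNIV) ?B"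
    by (simp add: compactin_PiE)
  then have "compact ?B" by (simp add: euclidean_product_topology)
  moreover have "closed {x. nrm d x \<le> 1}"
    by (intro closed_Collect_le continuous_on_nrm continuous_on_const)
  ultimately have "compact (?B \<inter> {x. nrm d x \<le> 1})" by (rule compact_Int_closed)
  also have "?B \<inter> {x. nrm d x \<le> 1} = unitball d"
  proof (intro equalityI subsetI)
    fix x assume "x \<in> ?B \<inter> {x. nrm d x \<le> 1}"
    then show "x \<in> unitball d"
      by (auto simp: unitball_def Rd_def PiE_def Pi_def extensional_def split: if_splits)
  next
    fix x assume x: "x \<in> unitball d"
    then have "\<bar>x i\<bar> \<le> 1" if "i < d" for i
      using abs_component_le_nrm[OF that, of x] by (auto simp: unitball_def)
    then show "x \<in> ?B \<inter> {x. nrm d x \<le> 1}"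
      using x by (auto simp: unitball_def Rd_def PiE_def extensional_def abs_le_iff minus_le_iff)
  qed
  finally show ?thesis .
qed

lemma continuous_on_vadd_vscale:
  "continuous_on S (\<lambda>(a, b). vadd d a (vscale d r b))"
proof -
  have "continuous_on S (\<lambda>p. vadd d (fst p) (vscale d r (snd p)))"
  proof (rule continuous_on_coordinatewise_then_product)
    fix i
    have 1: "continuous_on S (\<lambda>p. fst p i)" "continuous_on S (\<lambda>p. snd p i)"
      by (rule continuous_on_product_then_coordinatewise[OF continuous_on_fst[OF continuous_on_id]]
            continuous_on_product_then_coordinatewise[OF continuous_on_snd[OF continuous_on_id]])+
    show "continuous_on S (\<lambda>p. vadd d (fst p) (vscale d r (snd p)) i)"
    proof (cases "i < d")
      case True
      have "continuous_on S (\<lambda>p. fst p i + r * snd p i)"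
        by (rule continuous_on_add[OF 1(1) continuous_on_mult_left[OF 1(2)]])
      then show ?thesis using True by (simp add: vadd_def vscale_def)
    next
      case False
      then show ?thesis by (simp add: vadd_def)
    qed
  qed
  then show ?thesis by (simp add: case_prod_beta')
qed

lemma compact_msum_ball:
  assumes "compact K"
  shows "compact (msum d K (vscale d r ` unitball d))"
proof -
  have eq: "msum d K (vscale d r ` unitball d) = (\<lambda>(a, b). vadd d a (vscale d r b)) ` (K \<times> unitball d)"
    by (auto simp: msum_def)
  show ?thesis
    unfolding eq by (rule compact_continuous_image[OF continuous_on_vadd_vscale compact_Times[OF assms compact_unitball]])
qed

section \<open>Convexity in coordinates\<close>

definition convex_in :: "nat \<Rightarrow> (nat \<Rightarrow> real) set \<Rightarrow> bool" where
  "convex_in d A \<longleftrightarrow> (\<forall>x\<in>A. \<forall>y\<in>A. \<forall>u. 0 \<le> u \<longrightarrow> u \<le> 1 \<longrightarrow> vadd d (vscale d (1 - u) x) (vscale d u y) \<in> A)"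

lemma convex_inD:
  "convex_in d A \<Longrightarrow> x \<in> A \<Longrightarrow> y \<in> A \<Longrightarrow> 0 \<le> u \<Longrightarrow> u \<le> 1 \<Longrightarrow> vadd d (vscale d (1 - u) x) (vscale d u y) \<in> A"
  by (simp add: convex_in_def)

lemma convex_in_unitball: "convex_in d (unitball d)"
  unfolding convex_in_def
proof (intro ballI allI impI)
  fix x y and u :: real assume *: "x \<in> unitball d" "y \<in> unitball d" "0 \<le> u" "u \<le> 1"
  have "nrm d (vadd d (vscale d (1 - u) x) (vscale d u y)) \<le> (1 - u) * nrm d x + u * nrm d y"
    using nrm_vadd[of d "vscale d (1 - u) x" "vscale d u y"] * by (simp add: nrm_vscale)
  also have "\<dots> \<le> (1 - u) * 1 + u * 1"
    using * by (intro add_mono mult_left_mono) (auto simp: unitball_def)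
  finally show "vadd d (vscale d (1 - u) x) (vscale d u y) \<in> unitball d" by (simp add: unitball_def)
qed

lemma convex_in_Int_halfspace:
  assumes "convex_in d K"
  shows "convex_in d (K \<inter> {w \<in> Rd d. c \<le> ip d w v})"
  unfolding convex_in_def
proof (intro ballI allI impI)
  fix x y and u :: real
  assume *: "x \<in> K \<inter> {w \<in> Rd d. c \<le> ip d w v}" "y \<in> K \<inter> {w \<in> Rd d. c \<le> ip d w v}" "0 \<le> u" "u \<le> 1"
  have "(1 - u) * c + u * c \<le> (1 - u) * ip d x v + u * ip d y v"
    using * by (intro add_mono mult_left_mono) auto
  then show "vadd d (vscale d (1 - u) x) (vscale d u y) \<in> K \<inter> {w \<in> Rd d. c \<le> ip d w v}"
    using * convex_inD[OF assms, of x y u] by (simp add: ip_vadd ip_vscale algebra_simps)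
qed

lemma convex_in_msum_ball:
  assumes "convex_in d K"
  shows "convex_in d (msum d K (vscale d r ` unitball d))"
  unfolding convex_in_def
proof (intro ballI allI impI)
  fix x y and u :: real
  assume xy: "x \<in> msum d K (vscale d r ` unitball d)" "y \<in> msum d K (vscale d r ` unitball d)" and u: "0 \<le> u" "u \<le> 1"
  obtain a b where ab: "a \<in> K" "b \<in> unitball d" "x = vadd d a (vscale d r b)" using xy(1) by (auto simp: msum_def)
  obtain a' b' where ab': "a' \<in> K" "b' \<in> unitball d" "y = vadd d a' (vscale d r b')" using xy(2) by (auto simp: msum_def)
  have "vadd d (vscale d (1 - u) x) (vscale d u y)
    = vadd d (vadd d (vscale d (1 - u) a) (vscale d u a')) (vscale d r (vadd d (vscale d (1 - u) b) (vscale d u b')))"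
    by (auto simp: ab ab' vadd_def vscale_def fun_eq_iff algebra_simps)
  moreover have "vadd d (vscale d (1 - u) a) (vscale d u a') \<in> K" by (rule convex_inD[OF assms ab(1) ab'(1) u])
  moreover have "vadd d (vscale d (1 - u) b) (vscale d u b') \<in> unitball d" by (rule convex_inD[OF convex_in_unitball ab(2) ab'(2) u])
  ultimately show "vadd d (vscale d (1 - u) x) (vscale d u y) \<in> msum d K (vscale d r ` unitball d)"
    by (auto simp: msum_def)
qed

text \<open>The ball is sandwiched between cubes of half-width \<open>1 / d\<close> and
  \<open>1\<close>; the inner inclusion bounds the Euclidean norm by the sum of absolute
  values.\<close>

lemma emeasure_unitball:
  assumes "d \<ge> 1"
  shows "0 < emeasure (lebd d) (unitball d)" "emeasure (lebd d) (unitball d) < \<infinity>"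
proof -
  interpret product_sigma_finite "\<lambda>_. lborel :: real measure" by (rule product_sigma_finite_lborel)
  have meas: "unitball d \<in> sets (lebd d)"
    by (rule compact_imp_sets_lebd[OF compact_unitball]) (auto simp: unitball_def)
  have box: "emeasure (lebd d) (PiE {..<d} (\<lambda>_. {-s..s})) = ennreal ((2 * s) ^ d)" if "s \<ge> 0" for s :: real
    unfolding lebd_def using that by (subst emeasure_PiM) (auto simp: ennreal_power)
  have "PiE {..<d} (\<lambda>_. {- (1 / real d)..1 / real d}) \<subseteq> unitball d"
  proof
    fix x assume x: "x \<in> PiE {..<d} (\<lambda>_. {- (1 / real d)..1 / real d})"
    have "L2_set x {..<d} \<le> (\<Sum>i<d. \<bar>x i\<bar>)" by (rule L2_set_le_sum_abs)
    also have "\<dots> \<le> (\<Sum>i<d. 1 / real d)" using x by (intro sum_mono) (auto simp: PiE_def Pi_def abs_le_iff minus_le_iff)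
    also have "\<dots> = 1" using assms by simp
    finally show "x \<in> unitball d" using x by (auto simp: unitball_def nrm_eq_L2_set Rd_def)
  qed
  then have "emeasure (lebd d) (PiE {..<d} (\<lambda>_. {- (1 / real d)..1 / real d})) \<le> emeasure (lebd d) (unitball d)"
    using meas by (rule emeasure_mono)
  moreover have "0 < emeasure (lebd d) (PiE {..<d} (\<lambda>_. {- (1 / real d)..1 / real d}))"
    using assms by (subst box) auto
  ultimately show "0 < emeasure (lebd d) (unitball d)" by simp
  have "unitball d \<subseteq> PiE {..<d} (\<lambda>_. {- 1..1})"
  proof
    fix x assume x: "x \<in> unitball d"
    then have "\<bar>x i\<bar> \<le> 1" if "i < d" for i
      using abs_component_le_nrm[OF that, of x] by (auto simp: unitball_def)
    then show "x \<in> PiE {..<d} (\<lambda>_. {- 1..1})"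
      using x by (auto simp: unitball_def Rd_def PiE_def abs_le_iff minus_le_iff)
  qed
  then have "emeasure (lebd d) (unitball d) \<le> emeasure (lebd d) (PiE {..<d} (\<lambda>_. {- 1..1}))"
    by (rule emeasure_mono) (auto simp: lebd_def intro!: sets_PiM_I_finite)
  also have "\<dots> < \<infinity>" by (subst box) auto
  finally show "emeasure (lebd d) (unitball d) < \<infinity>" .
qed

section \<open>Shifted cuts near the centroid\<close>

text \<open>Turns the quotient of integrals in \<open>cg\<close> into an expectation under the
  uniform distribution.\<close>

lemma integral_uniform_measure:
  fixes f :: "'a \<Rightarrow> real"
  assumes A: "A \<in> sets M" "emeasure M A \<noteq> 0" "emeasure M A \<noteq> \<infinity>" and f: "f \<in> borel_measurable M"
  shows "(\<integral>x. f x \<partial>uniform_measure M A) = (LINT x:A|M. f x) / measure M A"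
proof -
  have pos: "measure M A > 0"
    using A by (simp add: measure_def enn2real_positive_iff less_top zero_less_iff_neq_zero)
  have em: "emeasure M A = ennreal (measure M A)" using A by (intro emeasure_eq_ennreal_measure) auto
  have "uniform_measure M A = density M (\<lambda>x. ennreal (indicator A x / measure M A))"
    unfolding uniform_measure_def
  proof (rule arg_cong[where f = "density M"], rule ext)
    fix x show "indicator A x / emeasure M A = ennreal (indicator A x / measure M A)"
      unfolding em using pos by (cases "x \<in> A") (auto simp: divide_ennreal[symmetric])
  qed
  then have "(\<integral>x. f x \<partial>uniform_measure M A) = (\<integral>x. (indicator A x / measure M A) *\<^sub>R f x \<partial>M)"
    using A(1) f by (simp only:) (rule integral_density, auto)
  also have "\<dots> = (\<integral>x. indicator A x *\<^sub>R f x / measure M A \<partial>M)"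
    by (intro Bochner_Integration.integral_cong) auto
  also have "\<dots> = (LINT x:A|M. f x) / measure M A"
    unfolding set_lebesgue_integral_def by (rule integral_divide_zero)
  finally show ?thesis .
qed

lemma sets_lebd_halfspace [simp]:
  "{x \<in> Rd d. ip d x v \<le> a} \<in> sets (lebd d)" "{x \<in> Rd d. ip d x v < a} \<in> sets (lebd d)"
proof -
  have "{x \<in> space (lebd d). ip d x v \<le> a} \<in> sets (lebd d)" by measurable
  then show "{x \<in> Rd d. ip d x v \<le> a} \<in> sets (lebd d)" by simp
  have "{x \<in> space (lebd d). ip d x v < a} \<in> sets (lebd d)" by measurable
  then show "{x \<in> Rd d. ip d x v < a} \<in> sets (lebd d)" by simp
qed

text \<open>Prekopa-Leindler for indicators: by convexity, midpoints of points from two sections of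
  \<open>L\<close> lie in the middle section. This supplies the log-concavity of the distribution
  function along \<open>v\<close>.\<close>

lemma brunn_minkowski_halfspaces:
  assumes L: "L \<in> sets (lebd d)" "L \<subseteq> Rd d" "convex_in d L" and fin: "emeasure (lebd d) L < \<infinity>"
  shows "measure (lebd d) {x \<in> L. ip d x v \<le> a} * measure (lebd d) {x \<in> L. ip d x v \<le> b}
    \<le> (measure (lebd d) {x \<in> L. ip d x v \<le> (a + b) / 2})\<^sup>2"
proof -
  let ?S = "\<lambda>a. {x \<in> L. ip d x v \<le> a}"
  have S: "?S a \<in> sets (lebd d)" for a
  proof -
    have "?S a = L \<inter> {x \<in> Rd d. ip d x v \<le> a}" using L(2) by auto
    then show ?thesis using sets.Int[OF L(1) sets_lebd_halfspace(1)] by simp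
  qed
  have em: "emeasure (lebd d) (?S a) = ennreal (measure (lebd d) (?S a))" for a
  proof (rule emeasure_eq_ennreal_measure)
    have "emeasure (lebd d) (?S a) \<le> emeasure (lebd d) L" using L(1) by (intro emeasure_mono) auto
    then show "emeasure (lebd d) (?S a) \<noteq> \<top>" using fin by (auto simp: top_unique)
  qed
  have "(\<integral>\<^sup>+x. indicator (?S a) x \<partial>PiM {..<d} (\<lambda>_. lborel)) * (\<integral>\<^sup>+x. indicator (?S b) x \<partial>PiM {..<d} (\<lambda>_. lborel))
    \<le> (\<integral>\<^sup>+x. indicator (?S ((a + b) / 2)) x \<partial>PiM {..<d} (\<lambda>_. lborel))\<^sup>2"
  proof (rule prekopa_leindler_PiM)
    fix x y :: "nat \<Rightarrow> real"
    let ?z = "\<lambda>i\<in>{..<d}. (x i + y i) / 2"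
    have "?z \<in> ?S ((a + b) / 2)" if xy: "x \<in> ?S a" "y \<in> ?S b"
    proof -
      have eq: "?z = vadd d (vscale d (1 - 1 / 2) x) (vscale d (1 / 2) y)"
        by (auto simp: vadd_def vscale_def fun_eq_iff)
      have "?z \<in> L" unfolding eq using xy by (intro convex_inD[OF L(3)]) auto
      moreover have "ip d ?z v \<le> (a + b) / 2" unfolding eq ip_vadd ip_vscale using xy by simp
      ultimately show ?thesis by simp
    qed
    then show "indicator (?S a) x * indicator (?S b) y \<le> (indicator (?S ((a + b) / 2)) ?z :: ennreal)\<^sup>2"
      by (auto split: split_indicator)
  qed (rule finite_lessThan borel_measurable_indicator S[unfolded lebd_def])+
  then have "emeasure (lebd d) (?S a) * emeasure (lebd d) (?S b) \<le> (emeasure (lebd d) (?S ((a + b) / 2)))\<^sup>2"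
    using S unfolding lebd_def by (simp only: nn_integral_indicator)
  then show ?thesis
    unfolding em by (simp add: ennreal_mult[symmetric] ennreal_power ennreal_le_iff)
qed

text \<open>\<open>1 - 1 / (d + 1)\<close> is the inverse of \<open>1 + 1 / d\<close>, whose
  \<open>d\<close>-th power is at most \<open>exp 1 \<le> 3\<close>, and
  \<open>d + 1 \<le> 2 * d\<close>. The product is the source of the \<open>6 * d\<close> in the
  threshold for cheap rounds.\<close>

lemma contraction_factor_bound:
  assumes "d \<ge> 1"
  shows "1 / (6 * real d) \<le> (1 - 1 / (real d + 1)) ^ d * (1 / (real d + 1))"
proof -
  have "(1 + 1 / real d) ^ d \<le> exp 1" using assms by (intro exp_ge_one_plus_x_over_n_power_n) auto
  then have le3: "(1 + 1 / real d) ^ d \<le> 3" using exp_le by linarith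
  have "1 - 1 / (real d + 1) = inverse (1 + 1 / real d)" using assms by (simp add: field_simps)
  then have "(1 - 1 / (real d + 1)) ^ d = inverse ((1 + 1 / real d) ^ d)" by (simp add: power_inverse)
  moreover have "inverse 3 \<le> inverse ((1 + 1 / real d) ^ d)"
    using le3 by (intro le_imp_inverse_le zero_less_power) (auto simp: add_pos_nonneg)
  ultimately have "1 / 3 \<le> (1 - 1 / (real d + 1)) ^ d" by simp
  moreover have "1 / (2 * real d) \<le> 1 / (real d + 1)" using assms by (intro divide_left_mono) auto
  ultimately have "1 / 3 * (1 / (2 * real d)) \<le> (1 - 1 / (real d + 1)) ^ d * (1 / (real d + 1))"
    by (intro mult_mono) auto
  then show ?thesis by simp
qed

section \<open>The uniform distribution on a bounded convex body\<close>

locale bounded_convex_body =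
  fixes d :: nat and L :: "(nat \<Rightarrow> real) set" and R :: real
  assumes d: "d \<ge> 1" and sets_L: "L \<in> sets (lebd d)" and L_Rd: "L \<subseteq> Rd d" and convex_L: "convex_in d L"
    and L_bounded: "\<And>x. x \<in> L \<Longrightarrow> nrm d x \<le> R"
    and emeasure_L_pos: "0 < emeasure (lebd d) L" and emeasure_L_fin: "emeasure (lebd d) L < \<infinity>"
begin

abbreviation N where "N \<equiv> uniform_measure (lebd d) L"

sublocale N: prob_space N
  using emeasure_L_pos emeasure_L_fin by (intro prob_space_uniform_measure) auto

lemma prob_Rd [simp]: "N.prob (Rd d) = 1"
  using N.prob_space by simp

lemma measure_L_pos: "measure (lebd d) L > 0"
  using emeasure_L_pos emeasure_L_fin by (simp add: measure_def enn2real_positive_iff)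

lemma AE_in_L: "AE x in N. x \<in> L"
  using sets_L by (intro AE_uniform_measureI) auto

lemma integrable_component: "i < d \<Longrightarrow> integrable N (\<lambda>x. x i)"
proof (rule N.integrable_const_bound[of _ R])
  assume i: "i < d"
  show "AE x in N. norm (x i) \<le> R"
    using AE_in_L by eventually_elim (use abs_component_le_nrm[OF i] L_bounded in \<open>auto intro: order_trans\<close>)
  show "(\<lambda>x. x i) \<in> borel_measurable N" using i by simp
qed

lemma integrable_ip: "integrable N (\<lambda>x. ip d x v)"
  unfolding ip_def using integrable_component by (intro Bochner_Integration.integrable_sum) auto

lemma expectation_ip: "N.expectation (\<lambda>x. ip d x v) = ip d (cg d L) v"
proof -
  have "N.expectation (\<lambda>x. ip d x v) = (\<Sum>i<d. N.expectation (\<lambda>x. x i * v i))"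
    unfolding ip_def using integrable_component by (intro Bochner_Integration.integral_sum) auto
  also have "\<dots> = (\<Sum>i<d. cg d L i * v i)"
  proof (rule sum.cong)
    fix i assume i: "i \<in> {..<d}"
    then show "N.expectation (\<lambda>x. x i * v i) = cg d L i * v i"
      using sets_L emeasure_L_pos emeasure_L_fin integral_uniform_measure[of L "lebd d" "\<lambda>x. x i"]
      by (simp add: cg_def)
  qed simp
  finally show ?thesis by (simp add: ip_def)
qed

text \<open>Cauchy-Schwarz holds at every point of \<open>L\<close> and survives averaging. This
  caps the loss of a round.\<close>

lemma abs_ip_centroid_le: "\<bar>ip d (cg d L) v\<bar> \<le> R * nrm d v"
proof -
  have bound: "AE x in N. \<bar>ip d x v\<bar> \<le> R * nrm d v"
    using AE_in_L
  proof eventually_elim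
    fix x assume "x \<in> L"
    then have "nrm d x * nrm d v \<le> R * nrm d v" using L_bounded nrm_nonneg by (intro mult_right_mono) auto
    then show "\<bar>ip d x v\<bar> \<le> R * nrm d v" using abs_ip_le[of d x v] by linarith
  qed
  have "N.expectation (\<lambda>x. ip d x v) \<le> R * nrm d v"
    using bound by (intro N.integral_le_const integrable_ip) (auto elim!: eventually_mono)
  moreover have "- (R * nrm d v) \<le> N.expectation (\<lambda>x. ip d x v)"
    using bound by (intro N.integral_ge_const integrable_ip) (auto elim!: eventually_mono)
  ultimately show ?thesis unfolding expectation_ip by linarith
qed

text \<open>The contraction of \<open>L\<close> towards \<open>q\<close> with ratio \<open>d / (d + 1)\<close> maps \<open>L\<close> into itself,
  keeps a constant fraction of the volume and moves the centroid by \<open>h / (d + 1)\<close>.\<close>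

lemma mean_positive_part_ge:
  fixes v :: "nat \<Rightarrow> real"
  defines "s \<equiv> \<lambda>x. ip d x v - ip d (cg d L) v"
  assumes q: "q \<in> L" and h: "0 \<le> s q"
  shows "s q / (6 * real d) \<le> N.expectation (\<lambda>x. max (s x) 0)"
proof -
  \<comment> \<open>This weight maximises \<open>l * (1 - l) ^ d\<close>, the displacement times the
    retained fraction of the volume.\<close>
  define l where "l = 1 / (real d + 1)"
  define c where "c = 1 - l"
  have l: "0 \<le> l" "l \<le> 1" and c: "c > 0" "0 \<le> c" "c \<le> 1" "1 - c = l"
    using d by (auto simp: l_def c_def)
  define \<phi> where "\<phi> x = vadd d (vscale d l q) (vscale d c x)" for x
  have s_meas[measurable]: "s \<in> borel_measurable (lebd d)" unfolding s_def by measurable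
  have int_s: "integrable N s" unfolding s_def using integrable_ip by simp
  have mean_s: "N.expectation s = 0" unfolding s_def using integrable_ip by (simp add: expectation_ip)
  have s_\<phi>: "s (\<phi> x) = c * s x + l * s q" for x
    unfolding s_def \<phi>_def ip_vadd ip_vscale c_def by (simp add: algebra_simps)
  have \<phi>_in: "\<phi> x \<in> L" if "x \<in> L" for x
  proof -
    have "\<phi> x = vadd d (vscale d (1 - l) x) (vscale d l q)"
      by (auto simp: \<phi>_def c_def vadd_def vscale_def fun_eq_iff)
    then show ?thesis using convex_inD[OF convex_L that q l] by simp
  qed
  let ?p = "\<lambda>x. ennreal (max (s x) 0)" and ?p' = "\<lambda>x. ennreal (max (c * s x + l * s q) 0)"
  \<comment> \<open>Substitution along \<open>\<phi>\<close>, with Jacobian \<open>c ^ d\<close>.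
    The inequality holds because \<open>\<phi>\<close> maps \<open>L\<close> into itself, so only
    the contribution of the contracted copy is kept.\<close>
  have "ennreal (c ^ d) * (\<integral>\<^sup>+x. ?p' x * indicator L x \<partial>lebd d)
    \<le> ennreal (c ^ d) * (\<integral>\<^sup>+x. ?p (\<phi> x) * indicator L (\<phi> x) \<partial>lebd d)"
    using \<phi>_in by (intro mult_left_mono nn_integral_mono) (auto simp: s_\<phi> split: split_indicator)
  also have "\<dots> = (\<integral>\<^sup>+x. ?p x * indicator L x \<partial>lebd d)"
    unfolding \<phi>_def using c(1) sets_L by (intro nn_integral_lebd_affine[symmetric]) auto
  finally have "ennreal (c ^ d) * (\<integral>\<^sup>+x. ?p' x * indicator L x \<partial>lebd d) / emeasure (lebd d) L
    \<le> (\<integral>\<^sup>+x. ?p x * indicator L x \<partial>lebd d) / emeasure (lebd d) L"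
    by (rule divide_right_mono_ennreal)
  then have "ennreal (c ^ d) * (\<integral>\<^sup>+x. ?p' x \<partial>N) \<le> (\<integral>\<^sup>+x. ?p x \<partial>N)"
    using sets_L by (simp add: nn_integral_uniform_measure ennreal_times_divide)
  also have "(\<integral>\<^sup>+x. ?p x \<partial>N) = ennreal (N.expectation (\<lambda>x. max (s x) 0))"
    using int_s by (intro nn_integral_eq_integral) auto
  also have "(\<integral>\<^sup>+x. ?p' x \<partial>N) = ennreal (N.expectation (\<lambda>x. max (c * s x + l * s q) 0))"
    using int_s by (intro nn_integral_eq_integral) auto
  finally have "ennreal (c ^ d * N.expectation (\<lambda>x. max (c * s x + l * s q) 0)) \<le> ennreal (N.expectation (\<lambda>x. max (s x) 0))"
    using c(2) by (simp add: ennreal_mult')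
  then have "c ^ d * N.expectation (\<lambda>x. max (c * s x + l * s q) 0) \<le> N.expectation (\<lambda>x. max (s x) 0)"
    by (subst (asm) ennreal_le_iff) auto
  moreover have "l * s q \<le> N.expectation (\<lambda>x. max (c * s x + l * s q) 0)"
  proof -
    \<comment> \<open>As \<open>s\<close> has mean zero, only the displacement
      \<open>l * s q\<close> remains.\<close>
    have "l * s q = N.expectation (\<lambda>x. c * s x + l * s q)"
      using int_s mean_s by simp
    also have "\<dots> \<le> N.expectation (\<lambda>x. max (c * s x + l * s q) 0)"
      using int_s by (intro integral_mono) auto
    finally show ?thesis .
  qed
  then have "c ^ d * (l * s q) \<le> c ^ d * N.expectation (\<lambda>x. max (c * s x + l * s q) 0)"
    using c by (intro mult_left_mono) auto
  moreover have "1 / (6 * real d) * s q \<le> c ^ d * l * s q"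
    using contraction_factor_bound[OF d] h unfolding c_def l_def by (intro mult_right_mono)
  ultimately show ?thesis by (simp add: mult.assoc)
qed

text \<open>If \<open>q\<close> lies more than \<open>6 * d * r\<close> ahead of the centroid, the
  mean positive part of the signed distance exceeds \<open>r\<close>. The section at minus that mean
  has at least a sixteenth of the volume, and it lies strictly beyond depth
  \<open>r\<close>.\<close>

lemma shifted_centroid_cut:
  assumes q: "q \<in> L" and r: "0 \<le> r" and far: "6 * real d * r < ip d q v - ip d (cg d L) v"
  shows "measure (lebd d) L / 16 \<le> measure (lebd d) {x \<in> L. ip d x v < ip d (cg d L) v - r}"
proof -
  let ?m = "ip d (cg d L) v"
  define s where "s x = ip d x v - ?m" for x
  let ?D = "distr N borel s"
  have s_meas[measurable]: "s \<in> borel_measurable (lebd d)" unfolding s_def[abs_def] by measurable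
  have s_N: "s \<in> borel_measurable N" by simp
  interpret D: real_distribution ?D using s_N by (rule N.real_distribution_distr)
  have int_s: "integrable N s" unfolding s_def using integrable_ip by simp
  have mean_s: "N.expectation s = 0" unfolding s_def using integrable_ip by (simp add: expectation_ip)
  have cdf: "cdf ?D a = measure (lebd d) {x \<in> L. ip d x v \<le> ?m + a} / measure (lebd d) L" for a
  proof -
    have "cdf ?D a = measure N (s -` {..a} \<inter> space N)"
      unfolding cdf_def using s_N by (intro measure_distr) auto
    also have "\<dots> = measure (lebd d) (L \<inter> (s -` {..a} \<inter> space N)) / measure (lebd d) L"
      using emeasure_L_pos emeasure_L_fin measurable_sets[OF s_meas, of "{..a}"]
      by (intro measure_uniform_measure) auto
    also have "L \<inter> (s -` {..a} \<inter> space N) = {x \<in> L. ip d x v \<le> ?m + a}"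
      using L_Rd by (auto simp: s_def)
    finally show ?thesis .
  qed
  define e where "e = N.expectation (\<lambda>x. max (s x) 0)"
  have "1 / 16 \<le> cdf ?D (- D.expectation (\<lambda>x. max x 0))"
  proof (rule D.cdf_neg_mean_positive_part)
    fix a b
    have eq: "(?m + a + (?m + b)) / 2 = ?m + (a + b) / 2" by (simp add: field_simps)
    show "cdf ?D a * cdf ?D b \<le> (cdf ?D ((a + b) / 2))\<^sup>2"
      unfolding cdf power_divide times_divide_times_eq power2_eq_square[of "measure (lebd d) L"]
      using brunn_minkowski_halfspaces[OF sets_L L_Rd convex_L emeasure_L_fin, of v "?m + a" "?m + b"]
      unfolding eq by (rule divide_right_mono) simp
  next
    have "AE x in N. s x \<le> R * nrm d v - ?m"
      using AE_in_L
    proof eventually_elim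
      fix x assume "x \<in> L"
      then have "nrm d x * nrm d v \<le> R * nrm d v" using L_bounded nrm_nonneg by (intro mult_right_mono) auto
      then show "s x \<le> R * nrm d v - ?m" using abs_ip_le[of d x v] unfolding s_def by linarith
    qed
    then show "AE x in ?D. x \<le> R * nrm d v - ?m" using s_N by (subst AE_distr_iff) auto
    show "integrable ?D (\<lambda>x. x)" using s_N int_s by (subst integrable_distr_eq) auto
    show "D.expectation (\<lambda>x. x) = 0" using s_N mean_s by (subst integral_distr) auto
  qed
  also have "D.expectation (\<lambda>x. max x 0) = e" unfolding e_def using s_N by (subst integral_distr) auto
  finally have "1 / 16 \<le> measure (lebd d) {x \<in> L. ip d x v \<le> ?m - e} / measure (lebd d) L"
    unfolding cdf by simp
  then have "measure (lebd d) L / 16 \<le> measure (lebd d) {x \<in> L. ip d x v \<le> ?m - e}"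
    using measure_L_pos by (simp add: pos_le_divide_eq)
  also have "\<dots> \<le> measure (lebd d) {x \<in> L. ip d x v < ?m - r}"
  proof -
    have "0 \<le> 6 * real d * r" using r by simp
    then have "0 \<le> s q" using far unfolding s_def by linarith
    then have "s q / (6 * real d) \<le> e"
      using mean_positive_part_ge[OF q, of v] unfolding e_def s_def by simp
    moreover have "r < s q / (6 * real d)" using far d unfolding s_def by (simp add: field_simps)
    ultimately have "r < e" by simp
    then have sub: "{x \<in> L. ip d x v \<le> ?m - e} \<subseteq> {x \<in> L. ip d x v < ?m - r}" by auto
    have eq: "{x \<in> L. ip d x v < ?m - r} = L \<inter> {x \<in> Rd d. ip d x v < ?m - r}"
      "{x \<in> L. ip d x v \<le> ?m - e} = L \<inter> {x \<in> Rd d. ip d x v \<le> ?m - e}"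
      using L_Rd by auto
    show ?thesis
    proof (rule measure_mono_fmeasurable[OF sub])
      show "{x \<in> L. ip d x v \<le> ?m - e} \<in> sets (lebd d)" unfolding eq by (intro sets.Int sets_L sets_lebd_halfspace)
      have "{x \<in> L. ip d x v < ?m - r} \<in> sets (lebd d)" unfolding eq by (intro sets.Int sets_L sets_lebd_halfspace)
      moreover have "L \<in> fmeasurable (lebd d)" using sets_L emeasure_L_fin by (simp add: fmeasurable_def)
      ultimately show "{x \<in> L. ip d x v < ?m - r} \<in> fmeasurable (lebd d)"
        by (rule fmeasurableI2[rotated 2]) auto
    qed
  qed
  finally show ?thesis .
qed

end

section \<open>Regret of the algorithm\<close>

lemma ks_subset_unitball: "ks d T v t \<subseteq> unitball d"
  by (induction t) auto

lemma compact_ks: "compact (ks d T v t)"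
proof (induction t)
  case 0
  then show ?case by (simp add: compact_unitball)
next
  case (Suc t)
  let ?c = "ip d (query d T v t) (v t)"
  have "ks d T v (Suc t) = ks d T v t \<inter> {w. ?c \<le> ip d w (v t)}"
    using ks_subset_unitball[of d T v t] by (auto simp: query_def unitball_def)
  moreover have "closed {w. ?c \<le> ip d w (v t)}"
    by (intro closed_Collect_le continuous_on_ip continuous_on_const)
  ultimately show ?case using Suc.IH by (simp only: compact_Int_closed)
qed

lemma convex_in_ks: "convex_in d (ks d T v t)"
  by (induction t) (auto simp: convex_in_unitball intro: convex_in_Int_halfspace)

lemma vadd_vscale_zero: "w \<in> Rd d \<Longrightarrow> vadd d w (vscale d r (\<lambda>i\<in>{..<d}. 0)) = w"
  by (auto simp: vadd_def vscale_def Rd_def PiE_def extensional_def fun_eq_iff)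

lemma zero_in_unitball: "(\<lambda>i\<in>{..<d}. 0) \<in> unitball d"
  by (simp add: unitball_def Rd_def nrm_def ip_def)

text \<open>The answers enter as a fixed sequence. An adaptive oracle is covered as well, since any
  answers it gives form such a sequence, separating \<open>w\<close> from the queries which they
  themselves determine.\<close>

locale cutting_plane_run =
  fixes d T :: nat and w :: "nat \<Rightarrow> real" and v :: "nat \<Rightarrow> nat \<Rightarrow> real"
  assumes d: "d \<ge> 1" and T: "T \<ge> 1" and w: "w \<in> unitball d"
    and nrm_v: "\<And>t. t < T \<Longrightarrow> nrm d (v t) = 1"
    and separation: "\<And>t. t < T \<Longrightarrow> ip d (query d T v t) (v t) \<le> ip d w (v t)"
begin

text \<open>The set \<open>L\<^sub>t\<close> whose volume is the potential. For
  \<open>t \<le> T\<close> the inflation keeps the volume positive even if the knowledge set is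
  flat.\<close>

definition body :: "nat \<Rightarrow> (nat \<Rightarrow> real) set" where
  "body t = msum d (ks d T v t) (vscale d (1 / real T) ` unitball d)"

lemma query_eq: "query d T v t = cg d (body t)"
  by (simp add: query_def body_def)

lemma w_in_ks: "t \<le> T \<Longrightarrow> w \<in> ks d T v t"
proof (induction t)
  case (Suc t)
  then show ?case using separation[of t] w by (auto simp: query_def unitball_def)
qed (simp add: w)

lemma body_Rd: "body t \<subseteq> Rd d"
  by (auto simp: body_def msum_def)

lemma sets_body: "body t \<in> sets (lebd d)"
  by (rule compact_imp_sets_lebd[OF _ body_Rd]) (simp add: body_def compact_msum_ball compact_ks)

lemma nrm_body: "x \<in> body t \<Longrightarrow> nrm d x \<le> 1 + 1 / real T"
proof -
  assume "x \<in> body t"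
  then obtain a b where ab: "a \<in> ks d T v t" "b \<in> unitball d" "x = vadd d a (vscale d (1 / real T) b)"
    by (auto simp: body_def msum_def)
  have "nrm d a \<le> 1" "nrm d b \<le> 1" using ab ks_subset_unitball[of d T v t] by (auto simp: unitball_def)
  moreover have "nrm d x \<le> nrm d a + 1 / real T * nrm d b"
    using nrm_vadd[of d a "vscale d (1 / real T) b"] ab by (simp add: nrm_vscale)
  moreover have "1 / real T * nrm d b \<le> 1 / real T * 1" using \<open>nrm d b \<le> 1\<close> by (intro mult_left_mono) auto
  ultimately show ?thesis by simp
qed

text \<open>The body lies in the ball of radius \<open>1 + 1 / T\<close> about the origin.\<close>

lemma emeasure_body_le: "emeasure (lebd d) (body t) \<le> ennreal ((1 + 1 / real T) ^ d) * emeasure (lebd d) (unitball d)"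
proof -
  let ?s = "1 + 1 / real T" and ?z = "\<lambda>i\<in>{..<d}. 0 :: real"
  have s: "?s > 0" by (simp add: add_pos_nonneg)
  have "emeasure (lebd d) (body t) = ennreal (?s ^ d) * emeasure (lebd d) {x \<in> Rd d. vadd d ?z (vscale d ?s x) \<in> body t}"
    by (rule emeasure_lebd_affine[OF sets_body s])
  also have "\<dots> \<le> ennreal (?s ^ d) * emeasure (lebd d) (unitball d)"
  proof (intro mult_left_mono emeasure_mono subsetI)
    fix x assume x: "x \<in> {x \<in> Rd d. vadd d ?z (vscale d ?s x) \<in> body t}"
    have "vadd d ?z (vscale d ?s x) = vscale d ?s x" by (auto simp: vadd_def vscale_def fun_eq_iff)
    then have "?s * nrm d x \<le> ?s * 1" using nrm_body[of "vscale d ?s x" t] x s by (simp add: nrm_vscale)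
    then have "nrm d x \<le> 1" using s by (subst (asm) mult_le_cancel_left_pos)
    then show "x \<in> unitball d" using x by (simp add: unitball_def)
  next
    show "unitball d \<in> sets (lebd d)" by (rule compact_imp_sets_lebd[OF compact_unitball]) (auto simp: unitball_def)
  qed simp
  finally show ?thesis .
qed

text \<open>The hidden point is never cut off, so the ball of radius \<open>1 / T\<close> about
  \<open>w\<close> stays inside the body.\<close>

lemma emeasure_body_ge:
  assumes "t \<le> T"
  shows "ennreal ((1 / real T) ^ d) * emeasure (lebd d) (unitball d) \<le> emeasure (lebd d) (body t)"
proof -
  let ?r = "1 / real T"
  let ?A = "{x \<in> Rd d. vadd d w (vscale d ?r x) \<in> body t}"
  have r: "?r > 0" using T by simp
  have "?A = (\<lambda>x. vadd d w (vscale d ?r x)) -` body t \<inter> space (lebd d)" by auto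
  then have meas: "?A \<in> sets (lebd d)" using measurable_sets[OF measurable_vadd_vscale sets_body] by metis
  have "unitball d \<subseteq> ?A"
    using w_in_ks[OF assms] by (auto simp: body_def msum_def unitball_def)
  then have "emeasure (lebd d) (unitball d) \<le> emeasure (lebd d) ?A" using meas by (rule emeasure_mono)
  then have "ennreal (?r ^ d) * emeasure (lebd d) (unitball d) \<le> ennreal (?r ^ d) * emeasure (lebd d) ?A"
    by (rule mult_left_mono) simp
  also have "\<dots> = emeasure (lebd d) (body t)" by (rule emeasure_lebd_affine[OF sets_body r, symmetric])
  finally show ?thesis .
qed

lemma bounded_convex_body: "t \<le> T \<Longrightarrow> bounded_convex_body d (body t) (1 + 1 / real T)"
proof
  assume t: "t \<le> T"
  have "0 < ennreal ((1 / real T) ^ d) * emeasure (lebd d) (unitball d)"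
    using T emeasure_unitball(1)[OF d] by (simp add: ennreal_zero_less_mult_iff)
  then show "0 < emeasure (lebd d) (body t)" using emeasure_body_ge[OF t] by (rule less_le_trans)
  have "ennreal ((1 + 1 / real T) ^ d) * emeasure (lebd d) (unitball d) < \<infinity>"
    using emeasure_unitball(2)[OF d] by (simp add: ennreal_mult_less_top)
  with emeasure_body_le[of t] show "emeasure (lebd d) (body t) < \<infinity>" by (rule le_less_trans)
  show "convex_in d (body t)" unfolding body_def by (rule convex_in_msum_ball[OF convex_in_ks])
qed (use d sets_body body_Rd nrm_body in auto)

lemma w_in_body: "t \<le> T \<Longrightarrow> w \<in> body t"
proof -
  assume t: "t \<le> T"
  have "w = vadd d w (vscale d (1 / real T) (\<lambda>i\<in>{..<d}. 0))"
    using w vadd_vscale_zero by (simp add: unitball_def)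
  then show ?thesis using w_in_ks[OF t] zero_in_unitball unfolding body_def msum_def by blast
qed

text \<open>The new knowledge set lies on the far side of the hyperplane through the centroid.
  Adding a vector of length at most \<open>1 / T\<close> moves its points back along the unit vector
  \<open>v t\<close> by at most \<open>1 / T\<close>.\<close>

lemma body_Suc_subset:
  assumes t: "t < T"
  shows "body (Suc t) \<subseteq> body t - {x \<in> body t. ip d x (v t) < ip d (cg d (body t)) (v t) - 1 / real T}"
proof
  fix x assume "x \<in> body (Suc t)"
  then obtain a b where ab: "a \<in> ks d T v (Suc t)" "b \<in> unitball d" "x = vadd d a (vscale d (1 / real T) b)"
    by (auto simp: body_def msum_def)
  have "a \<in> ks d T v t" using ab(1) by simp
  then have x: "x \<in> body t" using ab(2,3) by (auto simp: body_def msum_def)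
  have "- 1 \<le> ip d b (v t)" using abs_ip_le[of d b "v t"] nrm_v[OF t] ab(2) by (auto simp: unitball_def)
  then have "- (1 / real T) \<le> 1 / real T * ip d b (v t)"
    using mult_left_mono[of "- 1" "ip d b (v t)" "1 / real T"] by simp
  moreover have "ip d (cg d (body t)) (v t) \<le> ip d a (v t)" using ab(1) by (simp add: body_def)
  ultimately have "ip d (cg d (body t)) (v t) - 1 / real T \<le> ip d x (v t)"
    unfolding ab(3) ip_vadd ip_vscale by linarith
  then show "x \<in> body t - {x \<in> body t. ip d x (v t) < ip d (cg d (body t)) (v t) - 1 / real T}"
    using x by auto
qed

section \<open>The logarithm of the volume as potential\<close>

definition vol :: "nat \<Rightarrow> real" where "vol t = measure (lebd d) (body t)"

lemma vol_pos: "t \<le> T \<Longrightarrow> 0 < vol t"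
  unfolding vol_def by (rule bounded_convex_body.measure_L_pos[OF bounded_convex_body])

lemma fmeasurable_body: "t \<le> T \<Longrightarrow> body t \<in> fmeasurable (lebd d)"
  using bounded_convex_body.emeasure_L_fin[OF bounded_convex_body] sets_body by (auto simp: fmeasurable_def)

text \<open>A round is either cheap or leaves at most \<open>15 / 16\<close> of the volume. In the
  second case the loss is at most \<open>1 + 2 = 3\<close>, where \<open>2\<close> bounds
  \<open>1 + 1 / T\<close>; and \<open>3\<close> is \<open>48\<close> times the guaranteed
  logarithmic drop \<open>1 / 16\<close>.\<close>

lemma round_loss_le:
  assumes t: "t < T"
  shows "ip d w (v t) - ip d (query d T v t) (v t) \<le> 6 * real d / real T + 48 * (ln (vol t) - ln (vol (Suc t)))"
proof -
  let ?p = "ip d (cg d (body t)) (v t)"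
  let ?C = "{x \<in> body t. ip d x (v t) < ?p - 1 / real T}"
  have t': "t \<le> T" "Suc t \<le> T" using t by auto
  note body = bounded_convex_body[OF t'(1)]
  have C_eq: "?C = body t \<inter> {x \<in> Rd d. ip d x (v t) < ?p - 1 / real T}" using body_Rd by auto
  have C: "?C \<in> sets (lebd d)" unfolding C_eq by (rule sets.Int[OF sets_body sets_lebd_halfspace(2)])
  have "vol (Suc t) \<le> measure (lebd d) (body t - ?C)"
    unfolding vol_def
    by (rule measure_mono_fmeasurable[OF body_Suc_subset[OF t] sets_body fmeasurable_Diff[OF fmeasurable_body[OF t'(1)] C]])
  also have "\<dots> = vol t - measure (lebd d) ?C"
    unfolding vol_def using C fmeasurable_body[OF t'(1)]
    by (intro measure_Diff) (auto simp: fmeasurable_def less_top)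
  finally have drop: "vol (Suc t) \<le> vol t - measure (lebd d) ?C" .
  have vp: "0 < vol t" "0 < vol (Suc t)" using vol_pos t' by auto
  show ?thesis
  proof (cases "6 * real d * (1 / real T) < ip d w (v t) - ?p")
    case False
    have "vol (Suc t) \<le> vol t" using drop measure_nonneg[of "lebd d" ?C] by linarith
    then have "ln (vol (Suc t)) \<le> ln (vol t)" using vp by simp
    then show ?thesis using False by (simp add: query_eq)
  next
    case True
    have "vol t / 16 \<le> measure (lebd d) ?C"
      unfolding vol_def by (rule bounded_convex_body.shifted_centroid_cut[OF body w_in_body[OF t'(1)] _ True]) simp
    then have "vol (Suc t) \<le> 15 / 16 * vol t" using drop by simp
    then have "ln (vol (Suc t)) \<le> ln (15 / 16 * vol t)" using vp by simp
    also have "\<dots> = ln (15 / 16) + ln (vol t)" using vp by (intro ln_mult_pos) auto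
    also have "ln (15 / 16 :: real) \<le> 15 / 16 - 1" by (rule ln_le_minus_one) simp
    finally have "1 / 16 \<le> ln (vol t) - ln (vol (Suc t))" by simp
    moreover have "ip d w (v t) \<le> 1" using abs_ip_le[of d w "v t"] nrm_v[OF t] w by (auto simp: unitball_def)
    moreover have "\<bar>?p\<bar> \<le> 2"
    proof -
      have "1 / real T \<le> 1" using T by simp
      then show ?thesis using bounded_convex_body.abs_ip_centroid_le[OF body, of "v t"] nrm_v[OF t] by simp
    qed
    ultimately have "ip d w (v t) - ?p \<le> 48 * (ln (vol t) - ln (vol (Suc t)))" by (simp add: abs_le_iff)
    then show ?thesis by (simp add: query_eq add_increasing)
  qed
qed

text \<open>The two volume bounds belong to balls whose radii have the ratio
  \<open>(1 + 1 / T) / (1 / T) = T + 1\<close>.\<close>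

lemma ln_vol_diff_le: "ln (vol 0) - ln (vol T) \<le> real d * ln (real T + 1)"
proof -
  let ?b = "measure (lebd d) (unitball d)"
  have b_em: "emeasure (lebd d) (unitball d) = ennreal ?b"
    using emeasure_unitball(2)[OF d] by (intro emeasure_eq_ennreal_measure) auto
  have b: "?b > 0" using emeasure_unitball[OF d] by (simp add: measure_def enn2real_positive_iff)
  have em: "emeasure (lebd d) (body t) = ennreal (vol t)" if "t \<le> T" for t
    unfolding vol_def using bounded_convex_body.emeasure_L_fin[OF bounded_convex_body[OF that]]
    by (intro emeasure_eq_ennreal_measure) auto
  have "ennreal (vol 0) \<le> ennreal ((1 + 1 / real T) ^ d * ?b)"
    using emeasure_body_le[of 0] em[of 0] by (simp add: b_em ennreal_mult')
  then have up: "vol 0 \<le> (1 + 1 / real T) ^ d * ?b" using b by (subst (asm) ennreal_le_iff) auto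
  have "ennreal ((1 / real T) ^ d * ?b) \<le> ennreal (vol T)"
    using emeasure_body_ge[of T] em[of T] by (simp add: b_em ennreal_mult')
  then have low: "(1 / real T) ^ d * ?b \<le> vol T" using vol_pos[of T] by (subst (asm) ennreal_le_iff) auto
  have "vol 0 \<le> (1 + 1 / real T) ^ d * ?b" by (rule up)
  also have "1 + 1 / real T = (real T + 1) * (1 / real T)" using T by (simp add: field_simps)
  also have "((real T + 1) * (1 / real T)) ^ d * ?b = (real T + 1) ^ d * ((1 / real T) ^ d * ?b)"
    by (simp only: power_mult_distrib mult.assoc)
  also have "\<dots> \<le> (real T + 1) ^ d * vol T" using low by (intro mult_left_mono) auto
  finally have "ln (vol 0) \<le> ln ((real T + 1) ^ d * vol T)"
    using vol_pos[of 0] vol_pos[of T] by (intro ln_mono) auto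
  also have "\<dots> = real d * ln (real T + 1) + ln (vol T)"
    using vol_pos[of T] by (subst ln_mult) (auto simp: ln_realpow)
  finally show ?thesis by simp
qed

text \<open>The logarithmic drops telescope. The terms \<open>6 * d / T\<close> add up to
  \<open>6 * d\<close>, which is absorbed by \<open>ln (T + 1) \<ge> ln 2 \<ge> 1 / 2\<close>; this
  gives \<open>12 + 48 = 60\<close>.\<close>

lemma regret_le: "regret d T w v \<le> 60 * real d * ln (real T + 1)"
proof -
  have "regret d T w v \<le> (\<Sum>t<T. 6 * real d / real T + 48 * (ln (vol t) - ln (vol (Suc t))))"
    unfolding regret_def using round_loss_le by (intro sum_mono) auto
  also have "\<dots> = 6 * real d + 48 * (\<Sum>t<T. ln (vol t) - ln (vol (Suc t)))"
    using T by (simp add: sum.distrib sum_distrib_left)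
  also have "(\<Sum>t<T. ln (vol t) - ln (vol (Suc t))) = ln (vol 0) - ln (vol T)"
    by (rule sum_lessThan_telescope')
  also have "6 * real d + 48 * (ln (vol 0) - ln (vol T)) \<le> 12 * real d * ln (real T + 1) + 48 * (real d * ln (real T + 1))"
  proof -
    have "ln 2 \<le> ln (real T + 1)" using T by (intro ln_mono) auto
    then have "1 / 2 \<le> ln (real T + 1)" using ln2_ge_two_thirds by linarith
    then have "12 * real d * (1 / 2) \<le> 12 * real d * ln (real T + 1)" by (intro mult_left_mono) auto
    then show ?thesis using ln_vol_diff_le by simp
  qed
  finally show ?thesis by simp
qed

end

text \<open>At \<open>T = 1\<close> a bound by a multiple of \<open>ln T\<close> would be zero
  although the regret can be positive; hence \<open>real T + 1\<close>. Choosing \<open>C\<close>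
  before \<open>d\<close> makes the constant uniform in the dimension.\<close>

theorem theorem4p4:
  shows "\<exists>C::real. \<forall>d T w v. d \<ge> 1 \<longrightarrow> T \<ge> 1 \<longrightarrow> w \<in> unitball d \<longrightarrow>
     (\<forall>t<T. v t \<in> Rd d \<and> nrm d (v t) = 1 \<and> ip d w (v t) \<ge> ip d (query d T v t) (v t)) \<longrightarrow>
     regret d T w v \<le> C * real d * ln (real T + 1)"
proof (intro exI[of _ 60] allI impI)
  fix d T w v
  assume "d \<ge> 1" "T \<ge> 1" "w \<in> unitball d"
    "\<forall>t<T. v t \<in> Rd d \<and> nrm d (v t) = 1 \<and> ip d w (v t) \<ge> ip d (query d T v t) (v t)"
  then interpret cutting_plane_run d T w v by unfold_locales auto
  show "regret d T w v \<le> 60 * real d * ln (real T + 1)" by (rule regret_le)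
qed

end
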